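(* Let $(\mathcal C,\mathcal D)$ be a matched pair with $\mathcal C=\mathcal D^0\times\mathbb Z$ (the bundle of groups over $\mathcal D^0$ with fibres $\mathcal C_u=\{u\}\times\mathbb Z\cong\mathbb Z$), and let $q\ge0$. There are isomorphisms $$\alpha_0\colon\bigoplus_{u\in\mathcal D^0}\mathbb Z(\mathcal C_u\backslash u\mathcal D^q)\to H^h_{0,q}(\mathcal C,\mathcal D),\qquad \alpha_1\colon\bigoplus_{u\in\mathcal D^0}\mathbb Z(\mathcal C_u\backslash\mathrm{Per}(u\mathcal D^q))\to H^h_{1,q}(\mathcal C,\mathcal D)$$ satisfying $$\alpha_0([\![d]\!])=[r(d);d]+\mathrm{im}(d^h_{0,q})\qquad\text{and}\qquad\alpha_1([\![d]\!])=\sum_{d'\in[\![d]\!]}[1;d']+\mathrm{im}(d^h_{1,q}).$$ Moreover, $$H^h_{p,q}(\mathcal C,\mathcal D)\cong\begin{cases}\bigoplus_{u}(\mathbb Zu\mathcal D^q)_{\mathbb Z}&p=0\\ \bigoplus_{u}(\mathbb Zu\mathcal D^q)^{\mathbb Z}&p=1\\0&\text{otherwise}\end{cases}\ \cong\ \begin{cases}\bigoplus_{u}\mathbb Z(\mathcal C_u\backslash u\mathcal D^q)&p=0\\ \bigoplus_{u}\mathbb Z(\mathcal C_u\backslash\mathrm{Per}(u\mathcal D^q))&p=1\\0&\text{otherwise,}\end{cases}$$ where $u$ ranges over $\mathcal D^0$.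
   Context: A small category $\mathcal C$ is identified with its set of morphisms; $\mathcal C^0$ its identities (objects), $r,s$ codomain and domain, $\mathcal C^n$ the composable $n$-tuples; $u\mathcal D^q=\{d\in\mathcal D^q:r(d)=u\}$; $\mathcal C^p*\mathcal D^q$ the composable tuples with first $p$ entries in $\mathcal C$ and last $q$ in $\mathcal D$ (when $\mathcal C^0=\mathcal D^0$; $\mathcal C^0*\mathcal D^q=\mathcal D^q$, $\mathcal C^p*\mathcal D^0=\mathcal C^p$). A matched pair $(\mathcal C,\mathcal D)$: small categories with $\mathcal C^0=\mathcal D^0$, a left action $\triangleright\colon\mathcal C*\mathcal D\to\mathcal D$ ($r(d)\triangleright d=d$, $r(c\triangleright d)=r(c)$, $(c_1c_2)\triangleright d=c_1\triangleright(c_2\triangleright d)$, $c\triangleright s(c)=r(c)$) and a right action $\triangleleft\colon\mathcal C*\mathcal D\to\mathcal C$ ($c\triangleleft s(c)=c$, $s(c\triangleleft d)=s(d)$, $c\triangleleft(d_1d_2)=(c\triangleleft d_1)\triangleleft d_2$, $r(d)\triangleleft d=s(d)$) with $s(c\triangleright d)=r(c\triangleleft d)$, $c\triangleright(d_1d_2)=(c\triangleright d_1)((c\triangleleft d_1)\triangleright d_2)$, $(c_1c_2)\triangleleft d=(c_1\triangleleft(c_2\triangleright d))(c_2\triangleleft d)$. $\mathcal C$ acts on $\mathcal D^q$ by $c\triangleright(d_1,\dots,d_q)=(c\triangleright d_1,(c\triangleleft d_1)\triangleright d_2,\dots,(c\triangleleft(d_1\cdots d_{q-1}))\triangleright d_q)$.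 $C_{p,q}=\mathbb Z(\mathcal C^p*\mathcal D^q)$, and $d^h_{p,q}\colon C_{p+1,q}\to C_{p,q}$ sends $[c_0,\dots,c_p;d]$ to $[c_1,\dots,c_p;d]+\sum_{i=1}^p(-1)^i[c_0,\dots,c_{i-1}c_i,\dots,c_p;d]+(-1)^{p+1}[c_0,\dots,c_{p-1};c_p\triangleright d]$ (for $q=0$: the categorical boundary, deleting the last entry in the last term, and $[c]\mapsto[s(c)]-[r(c)]$ for $p=q=0$). $H^h_{p,q}(\mathcal C,\mathcal D)$ is the $p$-th homology of the row $(C_{\bullet,q},d^h_{\bullet,q})$. $\mathcal C_u\cong\mathbb Z$ acts on the set $u\mathcal D^q$ via $\triangleright$, hence on $\mathbb Zu\mathcal D^q$. For a set $X$ with a left $\mathbb Z$-action, $\mathbb Z\backslash X$ is the set of orbits, $[\![x]\!]$ the orbit of $x$, $\mathrm{Per}(X)$ the set of points with finite orbit ($k\triangleright x=x$ for some $k\ne0$). For a $\mathbb Z$-module $M$ (abelian group with $\mathbb Z$-action), $M^{\mathbb Z}$ is the group of invariants and $M_{\mathbb Z}=M/\langle k\cdot m-m\rangle$ the coinvariants. $[r(d);d]$ denotes the generator $[d]$ of $C_{0,q}$, and $[1;d']$ denotes the generator $[(r(d'),1);d']$ of $C_{1,q}$. *)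

theory Defs
  imports
    "HOL-Algebra.Free_Abelian_Groups"
    "HOL-Algebra.Group_Action"
begin

section \<open>Small categories\<close>

text \<open>
  Objects and morphisms are kept in separate types, linked by \<open>ident\<close>; an object \<open>u\<close> corresponds to
  the identity morphism \<open>ident C u\<close>. Two categories with the same identities are then two categories
  over the same object set. A morphism \<open>c\<close> goes from \<open>src C c\<close> to \<open>rng C c\<close>, and
  \<open>cmp C c d\<close> is the product \<open>c d\<close>, which is meaningful if \<open>src C c = rng C d\<close>.
\<close>

record ('o, 'm) cat =
  Obj :: "'o set"
  Mor :: "'m set"
  rng :: "'m \<Rightarrow> 'o"
  src :: "'m \<Rightarrow> 'o"
  ident :: "'o \<Rightarrow> 'm"
  cmp :: "'m \<Rightarrow> 'm \<Rightarrow> 'm"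

locale small_category =
  fixes C :: "('o, 'm) cat"
  assumes rng_closed: "c \<in> Mor C \<Longrightarrow> rng C c \<in> Obj C"
    and src_closed: "c \<in> Mor C \<Longrightarrow> src C c \<in> Obj C"
    and ident_closed: "u \<in> Obj C \<Longrightarrow> ident C u \<in> Mor C"
    and rng_ident: "u \<in> Obj C \<Longrightarrow> rng C (ident C u) = u"
    and src_ident: "u \<in> Obj C \<Longrightarrow> src C (ident C u) = u"
    and cmp_closed: "\<lbrakk>c \<in> Mor C; d \<in> Mor C; src C c = rng C d\<rbrakk> \<Longrightarrow> cmp C c d \<in> Mor C"
    and rng_cmp: "\<lbrakk>c \<in> Mor C; d \<in> Mor C; src C c = rng C d\<rbrakk> \<Longrightarrow> rng C (cmp C c d) = rng C c"
    and src_cmp: "\<lbrakk>c \<in> Mor C; d \<in> Mor C; src C c = rng C d\<rbrakk> \<Longrightarrow> src C (cmp C c d) = src C d"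
    and ident_left: "c \<in> Mor C \<Longrightarrow> cmp C (ident C (rng C c)) c = c"
    and ident_right: "c \<in> Mor C \<Longrightarrow> cmp C c (ident C (src C c)) = c"
    and cmp_assoc: "\<lbrakk>c \<in> Mor C; d \<in> Mor C; e \<in> Mor C; src C c = rng C d; src C d = rng C e\<rbrakk>
      \<Longrightarrow> cmp C (cmp C c d) e = cmp C c (cmp C d e)"

text \<open>The bundle of groups \<open>U \<times> \<int>\<close> over \<open>U\<close>.\<close>

definition int_bundle :: "'o set \<Rightarrow> ('o, 'o \<times> int) cat" where
  "int_bundle U = \<lparr>Obj = U, Mor = U \<times> UNIV, rng = fst, src = fst,
     ident = (\<lambda>u. (u, 0)), cmp = (\<lambda>c d. (fst c, snd c + snd d))\<rparr>"

definition vertex_group :: "('o, 'm) cat \<Rightarrow> 'o \<Rightarrow> 'm monoid" where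
  "vertex_group C u = \<lparr>carrier = {c \<in> Mor C. rng C c = u \<and> src C c = u},
     monoid.mult = cmp C, one = ident C u\<rparr>"


section \<open>Matched pairs\<close>

text \<open>\<open>lact c d\<close> is \<open>c \<triangleright> d\<close> and \<open>ract c d\<close> is \<open>c \<triangleleft> d\<close>; both only matter if \<open>src C c = rng D d\<close>.\<close>

locale matched_pair = C: small_category C + D: small_category D
  for C :: "('o, 'c) cat" and D :: "('o, 'd) cat" +
  fixes lact :: "'c \<Rightarrow> 'd \<Rightarrow> 'd" and ract :: "'c \<Rightarrow> 'd \<Rightarrow> 'c"
  assumes same_objects: "Obj C = Obj D"
    and lact_closed: "\<lbrakk>c \<in> Mor C; d \<in> Mor D; src C c = rng D d\<rbrakk> \<Longrightarrow> lact c d \<in> Mor D"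
    and lact_ident: "d \<in> Mor D \<Longrightarrow> lact (ident C (rng D d)) d = d"
    and rng_lact: "\<lbrakk>c \<in> Mor C; d \<in> Mor D; src C c = rng D d\<rbrakk> \<Longrightarrow> rng D (lact c d) = rng C c"
    and cmp_lact: "\<lbrakk>c1 \<in> Mor C; c2 \<in> Mor C; d \<in> Mor D; src C c1 = rng C c2; src C c2 = rng D d\<rbrakk>
      \<Longrightarrow> lact (cmp C c1 c2) d = lact c1 (lact c2 d)"
    and lact_on_ident: "c \<in> Mor C \<Longrightarrow> lact c (ident D (src C c)) = ident D (rng C c)"
    and ract_closed: "\<lbrakk>c \<in> Mor C; d \<in> Mor D; src C c = rng D d\<rbrakk> \<Longrightarrow> ract c d \<in> Mor C"
    and ract_ident: "c \<in> Mor C \<Longrightarrow> ract c (ident D (src C c)) = c"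
    and src_ract: "\<lbrakk>c \<in> Mor C; d \<in> Mor D; src C c = rng D d\<rbrakk> \<Longrightarrow> src C (ract c d) = src D d"
    and ract_cmp: "\<lbrakk>c \<in> Mor C; d1 \<in> Mor D; d2 \<in> Mor D; src C c = rng D d1; src D d1 = rng D d2\<rbrakk>
      \<Longrightarrow> ract c (cmp D d1 d2) = ract (ract c d1) d2"
    and ract_on_ident: "d \<in> Mor D \<Longrightarrow> ract (ident C (rng D d)) d = ident C (src D d)"
    and src_lact: "\<lbrakk>c \<in> Mor C; d \<in> Mor D; src C c = rng D d\<rbrakk>
      \<Longrightarrow> src D (lact c d) = rng C (ract c d)"
    and lact_cmp: "\<lbrakk>c \<in> Mor C; d1 \<in> Mor D; d2 \<in> Mor D; src C c = rng D d1; src D d1 = rng D d2\<rbrakk>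
      \<Longrightarrow> lact c (cmp D d1 d2) = cmp D (lact c d1) (lact (ract c d1) d2)"
    and cmp_ract: "\<lbrakk>c1 \<in> Mor C; c2 \<in> Mor C; d \<in> Mor D; src C c1 = rng C c2; src C c2 = rng D d\<rbrakk>
      \<Longrightarrow> ract (cmp C c1 c2) d = cmp C (ract c1 (lact c2 d)) (ract c2 d)"


section \<open>Composable tuples\<close>

text \<open>\<open>composable C u [c\<^sub>1, \<dots>, c\<^sub>n] v\<close>: the tuple is composable, with \<open>r(c\<^sub>1) = u\<close> and \<open>s(c\<^sub>n) = v\<close>
  (and \<open>u = v\<close> if \<open>n = 0\<close>).\<close>

fun composable :: "('o, 'm) cat \<Rightarrow> 'o \<Rightarrow> 'm list \<Rightarrow> 'o \<Rightarrow> bool" where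
  "composable C u [] v \<longleftrightarrow> u = v"
| "composable C u (c # cs) v \<longleftrightarrow> c \<in> Mor C \<and> rng C c = u \<and> composable C (src C c) cs v"

fun path_cmp :: "('o, 'm) cat \<Rightarrow> 'o \<Rightarrow> 'm list \<Rightarrow> 'm" where
  "path_cmp C u [] = ident C u"
| "path_cmp C u (c # cs) = cmp C c (path_cmp C (src C c) cs)"

text \<open>
  An element of \<open>D\<^sup>q\<close> is a pair \<open>(u, [d\<^sub>1, \<dots>, d\<^sub>q])\<close> with \<open>u = r(d\<^sub>1)\<close>; for \<open>q = 0\<close> it is \<open>(u, [])\<close>, which
  stands for the object \<open>u\<close>. Thus \<open>fst\<close> is the map \<open>r\<close> on \<open>D\<^sup>q\<close>. An element of \<open>C\<^sup>p * D\<^sup>q\<close> is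
  \<open>([c\<^sub>1, \<dots>, c\<^sub>p], u, [d\<^sub>1, \<dots>, d\<^sub>q])\<close>, where \<open>u = s(c\<^sub>p)\<close> if \<open>p > 0\<close> and \<open>u = r(d\<^sub>1)\<close> if \<open>q > 0\<close>. Recording \<open>u\<close>
  covers the cases \<open>p = 0\<close> and \<open>q = 0\<close> without exceptions.
\<close>

definition tuples_at :: "('o, 'd) cat \<Rightarrow> nat \<Rightarrow> 'o \<Rightarrow> ('o \<times> 'd list) set" where
  "tuples_at D q u = {(v, ds). v = u \<and> u \<in> Obj D \<and> length ds = q \<and> (\<exists>w. composable D u ds w)}"

definition tuples :: "('o, 'c) cat \<Rightarrow> ('o, 'd) cat \<Rightarrow> nat \<Rightarrow> nat \<Rightarrow> ('c list \<times> 'o \<times> 'd list) set" where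
  "tuples C D p q = {(cs, d). \<exists>u v. composable C u cs v \<and> length cs = p \<and> d \<in> tuples_at D q v}"

text \<open>The action of \<open>c\<close> on \<open>D\<^sup>q\<close>; entry \<open>i\<close> (counted from \<open>0\<close>) is
  \<open>(c \<triangleleft> (d\<^sub>1 \<cdots> d\<^sub>i)) \<triangleright> d\<^bsub>i+1\<^esub>\<close>, the empty product being the identity at \<open>u = s(c)\<close>.\<close>

definition tuple_act :: "('o, 'c) cat \<Rightarrow> ('o, 'd) cat \<Rightarrow> ('c \<Rightarrow> 'd \<Rightarrow> 'd) \<Rightarrow> ('c \<Rightarrow> 'd \<Rightarrow> 'c)
    \<Rightarrow> 'c \<Rightarrow> 'o \<times> 'd list \<Rightarrow> 'o \<times> 'd list" where
  "tuple_act C D lact ract c = (\<lambda>(u, ds).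
     (rng C c, map (\<lambda>i. lact (ract c (path_cmp D u (take i ds))) (ds ! i)) [0..<length ds]))"


section \<open>Homology of the rows\<close>

definition row_chain :: "('o, 'c) cat \<Rightarrow> ('o, 'd) cat \<Rightarrow> nat \<Rightarrow> nat
    \<Rightarrow> (('c list \<times> 'o \<times> 'd list) \<Rightarrow>\<^sub>0 int) monoid" where
  "row_chain C D p q = free_Abelian_group (tuples C D p q)"

text \<open>\<open>row_boundary C D lact ract p\<close> is \<open>d\<^sup>h\<close> from bidegree \<open>(p+1, q)\<close> to \<open>(p, q)\<close>, given by the same
  formula for every \<open>q\<close>. For \<open>q = 0\<close> the last summand amounts to deleting the last entry of \<open>cs\<close>, since
  \<open>tuple_act\<close> then sends \<open>(s(c), [])\<close> to \<open>(r(c), [])\<close>.\<close>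

definition row_boundary :: "('o, 'c) cat \<Rightarrow> ('o, 'd) cat \<Rightarrow> ('c \<Rightarrow> 'd \<Rightarrow> 'd) \<Rightarrow> ('c \<Rightarrow> 'd \<Rightarrow> 'c) \<Rightarrow> nat
    \<Rightarrow> (('c list \<times> 'o \<times> 'd list) \<Rightarrow>\<^sub>0 int) \<Rightarrow> (('c list \<times> 'o \<times> 'd list) \<Rightarrow>\<^sub>0 int)" where
  "row_boundary C D lact ract p = frag_extend (\<lambda>(cs, d).
       frag_of (tl cs, d)
     + (\<Sum>i=1..p. frag_cmul ((-1) ^ i)
          (frag_of (take (i - 1) cs @ [cmp C (cs ! (i - 1)) (cs ! i)] @ drop (i + 1) cs, d)))
     + frag_cmul ((-1) ^ (p + 1)) (frag_of (butlast cs, tuple_act C D lact ract (last cs) d)))"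

definition row_cycles :: "('o, 'c) cat \<Rightarrow> ('o, 'd) cat \<Rightarrow> ('c \<Rightarrow> 'd \<Rightarrow> 'd) \<Rightarrow> ('c \<Rightarrow> 'd \<Rightarrow> 'c) \<Rightarrow> nat \<Rightarrow> nat
    \<Rightarrow> (('c list \<times> 'o \<times> 'd list) \<Rightarrow>\<^sub>0 int) set" where
  "row_cycles C D lact ract p q = (case p of
       0 \<Rightarrow> carrier (row_chain C D 0 q)
     | Suc n \<Rightarrow> kernel (row_chain C D (Suc n) q) (row_chain C D n q) (row_boundary C D lact ract n))"

definition row_image :: "('o, 'c) cat \<Rightarrow> ('o, 'd) cat \<Rightarrow> ('c \<Rightarrow> 'd \<Rightarrow> 'd) \<Rightarrow> ('c \<Rightarrow> 'd \<Rightarrow> 'c) \<Rightarrow> nat \<Rightarrow> nat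
    \<Rightarrow> (('c list \<times> 'o \<times> 'd list) \<Rightarrow>\<^sub>0 int) set" where
  "row_image C D lact ract p q = row_boundary C D lact ract p ` carrier (row_chain C D (Suc p) q)"

definition row_homology :: "('o, 'c) cat \<Rightarrow> ('o, 'd) cat \<Rightarrow> ('c \<Rightarrow> 'd \<Rightarrow> 'd) \<Rightarrow> ('c \<Rightarrow> 'd \<Rightarrow> 'c) \<Rightarrow> nat \<Rightarrow> nat
    \<Rightarrow> (('c list \<times> 'o \<times> 'd list) \<Rightarrow>\<^sub>0 int) set monoid" where
  "row_homology C D lact ract p q =
     subgroup_generated (row_chain C D p q) (row_cycles C D lact ract p q)
       Mod row_image C D lact ract p q"


section \<open>Orbits, invariants and coinvariants\<close>

definition periodic_points :: "('g, 'm) monoid_scheme \<Rightarrow> 'x set \<Rightarrow> ('g \<Rightarrow> 'x \<Rightarrow> 'x) \<Rightarrow> 'x set" where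
  "periodic_points G X act = {x \<in> X. finite (orbit G act x)}"

definition linear_act :: "('g \<Rightarrow> 'x \<Rightarrow> 'x) \<Rightarrow> 'g \<Rightarrow> ('x \<Rightarrow>\<^sub>0 int) \<Rightarrow> ('x \<Rightarrow>\<^sub>0 int)" where
  "linear_act act g = frag_extend (\<lambda>x. frag_of (act g x))"

definition invariant_subgroup :: "('g, 'm) monoid_scheme \<Rightarrow> 'a monoid \<Rightarrow> ('g \<Rightarrow> 'a \<Rightarrow> 'a) \<Rightarrow> 'a monoid" where
  "invariant_subgroup G M act = subgroup_generated M {x \<in> carrier M. \<forall>g \<in> carrier G. act g x = x}"

definition coinvariants :: "('g, 'm) monoid_scheme \<Rightarrow> 'a monoid \<Rightarrow> ('g \<Rightarrow> 'a \<Rightarrow> 'a) \<Rightarrow> 'a set monoid" where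
  "coinvariants G M act =
     M Mod generate M {act g x \<otimes>\<^bsub>M\<^esub> inv\<^bsub>M\<^esub> x |g x. g \<in> carrier G \<and> x \<in> carrier M}"

definition sum_inj :: "'i set \<Rightarrow> ('i \<Rightarrow> ('a, 'm) monoid_scheme) \<Rightarrow> 'i \<Rightarrow> 'a \<Rightarrow> ('i \<Rightarrow> 'a)" where
  "sum_inj I G i x = (\<lambda>j\<in>I. if j = i then x else \<one>\<^bsub>G j\<^esub>)"

end

theory Submission
  imports Defs
begin

text \<open>
  Fix \<open>X = D\<^sup>q\<close>, a set with an action \<open>T\<close> of the integers. The row is the unnormalized bar complex of
  \<open>\<int>\<close> with coefficients in \<open>\<int>X\<close>, and it is homotopy equivalent to the two-term complex
  \<open>1 - T 1 : \<int>X \<rightarrow> \<int>X\<close>: include by \<open>x \<mapsto> [1; x]\<close> and retract by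
  \<open>[a; x] \<mapsto> \<Sum>\<^bsub>0 \<le> i < a\<^esub> T i x\<close>, the homotopy being
  \<open>[a, \<sigma>] \<mapsto> [0, 0, \<sigma>] - \<Sum>\<^bsub>0 \<le> i < a\<^esub> [1, i, \<sigma>]\<close>. So the homology is that of the coinvariants of \<open>\<int>X\<close>
  in degree 0, of the invariants in degree 1, and zero above. Coinvariants are free on the orbits. An invariant
  finite sum is constant on orbits, so its support consists of finite orbits, and the invariants are free
  on the sums over finite orbits.
\<close>

section \<open>Groups and free Abelian groups\<close>

text \<open>Every quotient below is computed through this criterion. Keeping \<open>Z\<close> and
  \<open>B\<close> inside an ambient group \<open>G\<close> allows all conditions to be checked on
  elements of \<open>G\<close> rather than on cosets: \<open>inj\<close> says that the induced map
  has trivial kernel, \<open>surj\<close> that it reaches every coset of \<open>B\<close> in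
  \<open>Z\<close>.\<close>

lemma (in comm_group) iso_Mod_of_section:
  assumes F: "group F" and \<beta>: "\<beta> \<in> hom F G" and Z: "subgroup Z G" and B: "subgroup B G" "B \<subseteq> Z"
    and into: "\<And>f. f \<in> carrier F \<Longrightarrow> \<beta> f \<in> Z"
    and inj: "\<And>f. \<lbrakk>f \<in> carrier F; \<beta> f \<in> B\<rbrakk> \<Longrightarrow> f = \<one>\<^bsub>F\<^esub>"
    and surj: "\<And>z. z \<in> Z \<Longrightarrow> \<exists>f \<in> carrier F. z \<otimes> inv (\<beta> f) \<in> B"
  shows "(\<lambda>f. B #> \<beta> f) \<in> iso F (subgroup_generated G Z Mod B)"
proof -
  let ?K = "subgroup_generated G Z"
  interpret K: comm_group ?K by (rule abelian_subgroup_generated[OF comm_group_axioms])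
  have cK: "carrier ?K = Z" using Z by (rule subgroup.carrier_subgroup_generated_subgroup)
  have BK: "subgroup B ?K" using B by (simp add: subgroup_of_subgroup_generated)
  have coset: "B #>\<^bsub>?K\<^esub> x = B #> x" for x by (simp add: r_coset_def)
  interpret N: normal B ?K using K.normal_iff_subgroup BK by blast
  interpret Q: group "?K Mod B" by (rule N.factorgroup_is_group)
  have "\<beta> \<in> hom F ?K" using \<beta> into cK by (auto simp: hom_def)
  from Group.hom_compose[OF this N.r_coset_hom_Mod]
  have hom: "(\<lambda>f. B #> \<beta> f) \<in> hom F (?K Mod B)" by (simp add: o_def coset)
  interpret h: group_hom F "?K Mod B" "\<lambda>f. B #> \<beta> f"
    using F hom by (simp add: group_hom_def group_hom_axioms_def)
  have "inj_on (\<lambda>f. B #> \<beta> f) (carrier F)"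
    unfolding h.inj_on_one_iff
  proof (intro allI impI)
    fix f assume f: "f \<in> carrier F" "B #> \<beta> f = \<one>\<^bsub>?K Mod B\<^esub>"
    have "\<beta> f \<in> carrier G" using f \<beta> by (auto simp: hom_def)
    then have "\<beta> f \<in> B" using f B by (auto intro: coset_join1)
    then show "f = \<one>\<^bsub>F\<^esub>" using inj f by blast
  qed
  moreover have "(\<lambda>f. B #> \<beta> f) ` carrier F = carrier (?K Mod B)"
  proof
    show "carrier (?K Mod B) \<subseteq> (\<lambda>f. B #> \<beta> f) ` carrier F"
    proof
      fix X assume "X \<in> carrier (?K Mod B)"
      then obtain z where z: "z \<in> Z" "X = B #> z" by (auto simp: carrier_FactGroup coset cK)
      then obtain f where f: "f \<in> carrier F" "z \<otimes> inv (\<beta> f) \<in> B" using surj by blast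
      have c: "z \<in> carrier G" "\<beta> f \<in> carrier G"
        using subgroup.mem_carrier[OF Z z(1)] hom_in_carrier[OF \<beta> f(1)] by auto
      have "B #> (z \<otimes> inv \<beta> f) = B"
        using c f B by (intro coset_join2) simp_all
      then have "B #> z = B #> \<beta> f"
        using c subgroup.subset[OF B(1)] by (intro coset_mult_inv1)
      then show "X \<in> (\<lambda>f. B #> \<beta> f) ` carrier F" using z f by blast
    qed
  qed (use h.hom_closed in blast)
  ultimately show ?thesis using hom by (simp add: iso_def bij_betw_def)
qed

section \<open>Homomorphisms and subgroups of free Abelian groups\<close>

lemma hom_frag_extend:
  assumes "\<And>x. x \<in> S \<Longrightarrow> Poly_Mapping.keys (f x) \<subseteq> T"
  shows "frag_extend f \<in> hom (free_Abelian_group S) (free_Abelian_group T)"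
  using assms keys_frag_extend[of f] by (intro homI) (fastforce simp: frag_extend_add)+

lemma keys_diff_subset:
  "\<lbrakk>Poly_Mapping.keys z \<subseteq> S; Poly_Mapping.keys w \<subseteq> S\<rbrakk> \<Longrightarrow> Poly_Mapping.keys (z - w) \<subseteq> S"
  using keys_diff[of z w] by blast

lemma subgroup_free_Abelian_group_diff:
  assumes "subgroup B (free_Abelian_group S)" "a \<in> B" "b \<in> B"
  shows "a - b \<in> B"
  using assms subgroup.m_closed[of B _ a "- b"] subgroup.m_inv_closed[of B _ b] subgroup.subset
  by fastforce

lemma subgroup_free_Abelian_groupI:
  assumes "\<And>a. a \<in> B \<Longrightarrow> Poly_Mapping.keys a \<subseteq> S" "0 \<in> B" "\<And>a b. \<lbrakk>a \<in> B; b \<in> B\<rbrakk> \<Longrightarrow> a - b \<in> B"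
  shows "subgroup B (free_Abelian_group S)"
proof (rule group.subgroupI)
  have neg: "- b \<in> B" if "b \<in> B" for b using assms(3)[OF assms(2) that] by simp
  show "inv\<^bsub>free_Abelian_group S\<^esub> a \<in> B" if "a \<in> B" for a using that neg assms by simp
  show "a \<otimes>\<^bsub>free_Abelian_group S\<^esub> b \<in> B" if "a \<in> B" "b \<in> B" for a b
    using assms(3)[OF that(1) neg[OF that(2)]] by simp
qed (use assms in auto)


section \<open>Orbits of an integer action\<close>

locale int_action =
  fixes X :: "'x set" and T :: "int \<Rightarrow> 'x \<Rightarrow> 'x"
  assumes act_closed: "x \<in> X \<Longrightarrow> T k x \<in> X"
    and act_zero: "x \<in> X \<Longrightarrow> T 0 x = x"
    and act_add: "x \<in> X \<Longrightarrow> T (k + l) x = T k (T l x)"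
begin

text \<open>Stated without reference to a group; \<open>orbit_eq\<close> identifies it with the
  orbit under the vertex group of an object.\<close>

definition orb :: "'x \<Rightarrow> 'x set" where "orb x = range (\<lambda>k. T k x)"

definition Per :: "'x set" where "Per = {x \<in> X. finite (orb x)}"

definition rep :: "'x set \<Rightarrow> 'x" where "rep A = (SOME x. x \<in> A)"

text \<open>On an infinite orbit the inner sum takes the default value 0, so the map is applied to
  chains supported on finite orbits.\<close>

definition orbit_sum :: "('x set \<Rightarrow>\<^sub>0 int) \<Rightarrow> ('x \<Rightarrow>\<^sub>0 int)" where
  "orbit_sum = frag_extend (\<lambda>A. \<Sum>x\<in>A. frag_of x)"

lemma act_neg: "x \<in> X \<Longrightarrow> T (- k) (T k x) = x"
  using act_add[of x "- k" k] act_zero by simp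

lemma act_eq_iff: "\<lbrakk>x \<in> X; y \<in> X\<rbrakk> \<Longrightarrow> T k x = T k y \<longleftrightarrow> x = y"
  by (metis act_neg)

lemma orb_refl: "x \<in> X \<Longrightarrow> x \<in> orb x"
  unfolding orb_def using act_zero[of x] by (metis rangeI)

lemma orb_subset: "x \<in> X \<Longrightarrow> orb x \<subseteq> X"
  by (auto simp: orb_def act_closed)

lemma orb_act: "x \<in> X \<Longrightarrow> orb (T k x) = orb x"
proof -
  assume x: "x \<in> X"
  have "T l x = T (l - k) (T k x)" for l using act_add[OF x, of "l - k" k] by simp
  then have "T l x \<in> range (\<lambda>l. T l (T k x))" for l by blast
  then show ?thesis unfolding orb_def by (auto simp flip: act_add[OF x])
qed

lemma orb_eq: "\<lbrakk>x \<in> X; y \<in> orb x\<rbrakk> \<Longrightarrow> orb y = orb x"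
  by (metis orb_act orb_def rangeE)

lemma mem_orb_iff: "\<lbrakk>x \<in> X; y \<in> X\<rbrakk> \<Longrightarrow> y \<in> orb x \<longleftrightarrow> orb y = orb x"
  using orb_eq orb_refl by blast

lemma rep_mem: "x \<in> X \<Longrightarrow> rep (orb x) \<in> orb x"
  unfolding rep_def using orb_refl by (rule someI)

lemma rep_closed: "x \<in> X \<Longrightarrow> rep (orb x) \<in> X"
  using rep_mem orb_subset by blast

lemma orb_rep: "x \<in> X \<Longrightarrow> orb (rep (orb x)) = orb x"
  using rep_mem orb_eq by blast

lemma Per_subset: "Per \<subseteq> X"
  by (auto simp: Per_def)

section \<open>Quotients identifying the points of each orbit; coinvariants\<close>

text \<open>The map \<open>\<pi>\<close> to orbits kills \<open>B\<close> and has the section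
  \<open>\<beta>\<close> given by representatives. From \<open>\<pi> (\<beta> f) = f\<close> comes
  injectivity modulo \<open>B\<close>; surjectivity holds because a point and the representative of
  its orbit differ by an element of \<open>B\<close>. The labelling \<open>e\<close> allows one
  proof for both the coinvariants (\<open>e = id\<close>) and homology in degree 0
  (\<open>e = Pair []\<close>).\<close>

lemma iso_orbit_classes:
  assumes p: "\<And>x. x \<in> X \<Longrightarrow> p (e x) = x"
    and B: "subgroup B (free_Abelian_group (e ` X))"
    and diff: "\<And>x k. x \<in> X \<Longrightarrow> frag_of (e x) - frag_of (e (T k x)) \<in> B"
    and ker: "\<And>b. b \<in> B \<Longrightarrow> frag_extend (\<lambda>y. frag_of (orb (p y))) b = 0"
  shows "\<exists>\<alpha> \<in> iso (free_Abelian_group (orb ` X)) (free_Abelian_group (e ` X) Mod B).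
    \<forall>x \<in> X. \<alpha> (frag_of (orb x)) = B #>\<^bsub>free_Abelian_group (e ` X)\<^esub> frag_of (e x)"
proof -
  let ?G = "free_Abelian_group (e ` X)"
  interpret G: comm_group ?G by (rule abelian_free_Abelian_group)
  define \<beta> where "\<beta> = frag_extend (\<lambda>A. frag_of (e (rep A)))"
  define \<pi> where "\<pi> = frag_extend (\<lambda>y. frag_of (orb (p y)))"
  have "B \<subseteq> carrier ?G" using B subgroup.subset by blast
  have \<beta>: "\<beta> \<in> hom (free_Abelian_group (orb ` X)) ?G"
    unfolding \<beta>_def by (rule hom_frag_extend) (auto simp: rep_closed)
  have \<pi>\<beta>: "\<pi> (\<beta> f) = f" if "Poly_Mapping.keys f \<subseteq> orb ` X" for f
    using that by (induction f rule: frag_induction)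
      (auto simp: \<pi>_def \<beta>_def frag_extend_diff p rep_closed orb_rep)
  have \<beta>\<pi>: "z - \<beta> (\<pi> z) \<in> B" if "Poly_Mapping.keys z \<subseteq> e ` X" for z
    using that
  proof (induction z rule: frag_induction)
    case zero
    show ?case using subgroup.one_closed[OF B] by (simp add: \<pi>_def \<beta>_def)
  next
    case (one y)
    then obtain x where x: "x \<in> X" "y = e x" by blast
    obtain k where "rep (orb x) = T k x" using rep_mem[OF x(1)] by (auto simp: orb_def)
    then show ?case using diff[OF x(1)] x by (simp add: \<pi>_def \<beta>_def p)
  next
    case (diff a b)
    have "a - b - \<beta> (\<pi> (a - b)) = (a - \<beta> (\<pi> a)) - (b - \<beta> (\<pi> b))"
      by (simp add: \<pi>_def \<beta>_def frag_extend_diff)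
    then show ?case using diff subgroup_free_Abelian_group_diff[OF B] by metis
  qed
  \<comment> \<open>The whole group takes the role of \<open>Z\<close>; the subgroup generated by
    the full carrier is rewritten to \<open>?G\<close> at the end.\<close>
  have "(\<lambda>f. B #>\<^bsub>?G\<^esub> \<beta> f) \<in> iso (free_Abelian_group (orb ` X))
    (subgroup_generated ?G (carrier ?G) Mod B)"
  proof (rule G.iso_Mod_of_section[OF _ \<beta> G.subgroup_self B])
    show "\<beta> f \<in> carrier ?G" if "f \<in> carrier (free_Abelian_group (orb ` X))" for f
      using \<beta> that by (rule hom_in_carrier)
    show "f = \<one>\<^bsub>free_Abelian_group (orb ` X)\<^esub>"
      if "f \<in> carrier (free_Abelian_group (orb ` X))" "\<beta> f \<in> B" for f
      using that ker[of "\<beta> f"] \<pi>\<beta>[of f] by (simp add: \<pi>_def)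
    fix z assume z: "z \<in> carrier ?G"
    have "\<pi> \<in> hom ?G (free_Abelian_group (orb ` X))"
      unfolding \<pi>_def by (rule hom_frag_extend) (auto simp: p)
    then have f: "\<pi> z \<in> carrier (free_Abelian_group (orb ` X))" using z by (rule hom_in_carrier)
    then have "\<beta> (\<pi> z) \<in> carrier ?G" by (rule hom_in_carrier[OF \<beta>])
    then show "\<exists>f \<in> carrier (free_Abelian_group (orb ` X)). z \<otimes>\<^bsub>?G\<^esub> inv\<^bsub>?G\<^esub> \<beta> f \<in> B"
      using f \<beta>\<pi> z by (intro bexI[of _ "\<pi> z"]) auto
  qed (use \<open>B \<subseteq> carrier ?G\<close> in auto)
  moreover have "B #>\<^bsub>?G\<^esub> \<beta> (frag_of (orb x)) = B #>\<^bsub>?G\<^esub> frag_of (e x)" if x: "x \<in> X" for x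
  proof -
    have "frag_of (e x) - \<beta> (frag_of (orb x)) \<in> B"
      using \<beta>\<pi>[of "frag_of (e x)"] x by (simp add: \<pi>_def p)
    moreover have c: "\<beta> (frag_of (orb x)) \<in> carrier ?G" using x rep_closed by (simp add: \<beta>_def)
    ultimately have "frag_of (e x) \<otimes>\<^bsub>?G\<^esub> inv\<^bsub>?G\<^esub> \<beta> (frag_of (orb x)) \<in> B" by simp
    then have "B #>\<^bsub>?G\<^esub> (frag_of (e x) \<otimes>\<^bsub>?G\<^esub> inv\<^bsub>?G\<^esub> \<beta> (frag_of (orb x))) = B"
      using B \<open>B \<subseteq> carrier ?G\<close> by (intro G.coset_join2) blast+
    from G.coset_mult_inv1[OF this] show ?thesis
      using x c \<open>B \<subseteq> carrier ?G\<close> by simp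
  qed
  ultimately show ?thesis unfolding G.subgroup_generated_group_carrier by (intro bexI[of _ "\<lambda>f. B #>\<^bsub>?G\<^esub> \<beta> f"]) auto
qed

lemma linear_act_diff_closed:
  assumes "Poly_Mapping.keys z \<subseteq> X"
  shows "Poly_Mapping.keys (linear_act T k z - z) \<subseteq> X"
proof -
  have "Poly_Mapping.keys (linear_act T k z) \<subseteq> X"
    using assms keys_frag_extend[of "\<lambda>x. frag_of (T k x)" z] act_closed unfolding linear_act_def by fastforce
  then show ?thesis using assms keys_diff[of "linear_act T k z" z] by blast
qed

lemma group_coinvariants: "group (coinvariants integer_group (free_Abelian_group X) (linear_act T))"
proof -
  interpret M: comm_group "free_Abelian_group X" by (rule abelian_free_Abelian_group)
  show ?thesis
    unfolding coinvariants_def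
    using linear_act_diff_closed
    by (intro comm_group.axioms(2) M.abelian_FactGroup M.generate_is_subgroup) auto
qed

text \<open>The map to orbits is invariant under translation, so it kills the generators of the
  relations; conversely each difference of two points of an orbit is such a generator.\<close>

lemma iso_coinvariants:
  "free_Abelian_group (orb ` X) \<cong> coinvariants integer_group (free_Abelian_group X) (linear_act T)"
proof -
  let ?M = "free_Abelian_group X"
  let ?S = "{linear_act T g x \<otimes>\<^bsub>?M\<^esub> inv\<^bsub>?M\<^esub> x |g x. g \<in> carrier integer_group \<and> x \<in> carrier ?M}"
  interpret M: comm_group ?M by (rule abelian_free_Abelian_group)
  let ?\<pi> = "frag_extend (\<lambda>x. frag_of (orb x))"
  have S: "?S \<subseteq> carrier ?M" using linear_act_diff_closed by auto
  have B: "subgroup (generate ?M ?S) ?M" using S by (rule M.generate_is_subgroup)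
  have "?\<pi> (linear_act T k z) = ?\<pi> z" if "Poly_Mapping.keys z \<subseteq> X" for k z
    using that by (induction z rule: frag_induction) (auto simp: linear_act_def frag_extend_diff orb_act)
  then have "?S \<subseteq> {z \<in> carrier ?M. ?\<pi> z = 0}"
    by (auto simp: frag_extend_diff dest: subsetD[OF linear_act_diff_closed])
  moreover have "subgroup {z \<in> carrier ?M. ?\<pi> z = 0} ?M"
    by (rule subgroup_free_Abelian_groupI) (auto simp: frag_extend_diff dest: keys_diff[THEN subsetD])
  ultimately have ker: "generate ?M ?S \<subseteq> {z \<in> carrier ?M. ?\<pi> z = 0}"
    by (rule M.generate_subgroup_incl)
  have diff: "frag_of x - frag_of (T k x) \<in> generate ?M ?S" if x: "x \<in> X" for x k
  proof -
    have "frag_of (T k x) \<in> carrier ?M" using act_closed[OF x] by simp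
    \<comment> \<open>Translating the point \<open>T k x\<close> back by \<open>- k\<close> produces
      \<open>x\<close>, hence the difference in the required order.\<close>
    then have "linear_act T (- k) (frag_of (T k x)) \<otimes>\<^bsub>?M\<^esub> inv\<^bsub>?M\<^esub> frag_of (T k x) \<in> ?S"
      unfolding carrier_integer_group by blast
    then have "linear_act T (- k) (frag_of (T k x)) \<otimes>\<^bsub>?M\<^esub> inv\<^bsub>?M\<^esub> frag_of (T k x) \<in> generate ?M ?S"
      by (rule generate.incl)
    then show ?thesis using x by (simp only: linear_act_def) (simp add: act_neg act_closed)
  qed
  have "?\<pi> b = 0" if "b \<in> generate ?M ?S" for b using ker that by blast
  then obtain \<alpha> where "\<alpha> \<in> iso (free_Abelian_group (orb ` X)) (?M Mod generate ?M ?S)"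
    using iso_orbit_classes[where p = id and e = id and B = "generate ?M ?S", unfolded id_apply image_id,
      OF refl B diff] by meson
  then show ?thesis unfolding coinvariants_def by (rule is_isoI)
qed

section \<open>Orbit sums and invariants\<close>

text \<open>Distinct orbits are disjoint, so among the orbit sums only that of \<open>orb x\<close>
  can involve \<open>x\<close>. If \<open>orb x\<close> is infinite, both sides are 0 by the
  condition on the support of \<open>f\<close>.\<close>

lemma lookup_orbit_sum:
  assumes "Poly_Mapping.keys f \<subseteq> orb ` Per" "x \<in> X"
  shows "Poly_Mapping.lookup (orbit_sum f) x = Poly_Mapping.lookup f (orb x)"
  using assms(1)
proof (induction f rule: frag_induction)
  case (one A)
  then obtain y where y: "y \<in> X" "finite (orb y)" "A = orb y" by (auto simp: Per_def)
  then show ?case using assms(2)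
    by (simp add: orbit_sum_def lookup_sum mem_orb_iff)
qed (auto simp: orbit_sum_def frag_extend_diff lookup_minus)

lemma hom_orbit_sum: "orbit_sum \<in> hom (free_Abelian_group (orb ` Per)) (free_Abelian_group X)"
  unfolding orbit_sum_def
proof (rule hom_frag_extend)
  fix A assume "A \<in> orb ` Per"
  then show "Poly_Mapping.keys (\<Sum>x\<in>A. frag_of x) \<subseteq> X"
    using orb_subset Per_subset keys_sum[of frag_of A] by fastforce
qed

lemma orbit_sum_eq_0:
  assumes "Poly_Mapping.keys f \<subseteq> orb ` Per" "orbit_sum f = 0"
  shows "f = 0"
proof (rule poly_mapping_eqI)
  fix A show "Poly_Mapping.lookup f A = Poly_Mapping.lookup 0 A"
  proof (cases "A \<in> orb ` Per")
    case True
    then show ?thesis using assms lookup_orbit_sum[OF assms(1)] Per_subset by auto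
  next
    case False
    then show ?thesis using assms(1) by (metis in_keys_iff lookup_zero subsetD)
  qed
qed

text \<open>A translation permutes each finite orbit, being an injective map of a finite set to
  itself, so it only reindexes the sum.\<close>

lemma linear_act_orbit_sum:
  assumes "Poly_Mapping.keys f \<subseteq> orb ` Per"
  shows "linear_act T k (orbit_sum f) = orbit_sum f"
  using assms
proof (induction f rule: frag_induction)
  case (one A)
  then obtain y where y: "y \<in> X" "finite A" "A = orb y" by (auto simp: Per_def)
  have "inj_on (T k) A" using orb_subset[OF y(1)] y by (auto intro!: inj_onI dest: act_eq_iff[THEN iffD1, rotated 2])
  moreover have "T k ` A \<subseteq> A"
    using y by (auto simp: orb_def simp flip: act_add)
  ultimately have "bij_betw (T k) A A"
    using y(2) by (simp add: bij_betw_def endo_inj_surj)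
  then have "(\<Sum>x\<in>A. frag_of (T k x)) = (\<Sum>x\<in>A. frag_of x)"
    by (rule sum.reindex_bij_betw)
  then show ?case using y by (simp add: orbit_sum_def linear_act_def frag_extend_sum)
qed (auto simp: orbit_sum_def linear_act_def frag_extend_diff)

lemma lookup_linear_act:
  assumes "Poly_Mapping.keys z \<subseteq> X" "x \<in> X"
  shows "Poly_Mapping.lookup (linear_act T k z) (T k x) = Poly_Mapping.lookup z x"
  using assms(1)
  by (induction z rule: frag_induction)
    (auto simp: linear_act_def frag_extend_diff lookup_minus act_eq_iff assms(2))

text \<open>Invariance under the generator 1 propagates along the orbit in both directions. The
  cycle condition in degree 1 supplies exactly this invariance.\<close>

lemma lookup_invariant:
  assumes "Poly_Mapping.keys z \<subseteq> X" "linear_act T 1 z = z" "x \<in> X"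
  shows "Poly_Mapping.lookup z (T k x) = Poly_Mapping.lookup z x"
proof (induction k rule: int_induct[where k = 0])
  case base
  show ?case using assms by (simp add: act_zero)
next
  case (step1 k)
  have "T (k + 1) x = T 1 (T k x)" using act_add[OF assms(3), of 1 k] by (simp add: add.commute)
  then show ?case using step1 lookup_linear_act[of z "T k x" 1] assms act_closed by simp
next
  case (step2 k)
  have "T k x = T 1 (T (k - 1) x)" using act_add[OF assms(3), of 1 "k - 1"] by simp
  then show ?case using step2 lookup_linear_act[of z "T (k - 1) x" 1] assms act_closed by simp
qed

lemma invariant_imp_orbit_sum:
  assumes z: "Poly_Mapping.keys z \<subseteq> X" "linear_act T 1 z = z"
  shows "\<exists>f \<in> carrier (free_Abelian_group (orb ` Per)). orbit_sum f = z"
proof -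
  let ?K = "Poly_Mapping.keys z"
  \<comment> \<open>Each orbit meeting the support receives the coefficient of \<open>z\<close> at
    its representative, which by invariance is the coefficient at all its points. The finite support
    makes this a finite sum.\<close>
  define f where "f = (\<Sum>A \<in> orb ` ?K. frag_cmul (Poly_Mapping.lookup z (rep A)) (frag_of A))"
  have const: "Poly_Mapping.lookup z y = Poly_Mapping.lookup z x" if "x \<in> X" "y \<in> orb x" for x y
    using that lookup_invariant[OF z] by (auto simp: orb_def)
  have "?K \<subseteq> Per"
  proof
    fix x assume x: "x \<in> ?K"
    then have "orb x \<subseteq> ?K" using const[of x] z by (metis in_keys_iff subsetD subsetI)
    then show "x \<in> Per" using x z finite_subset[of "orb x" ?K] by (auto simp: Per_def)
  qed
  moreover have "Poly_Mapping.keys f \<subseteq> orb ` ?K"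
    unfolding f_def using keys_sum[of "\<lambda>A. frag_cmul (Poly_Mapping.lookup z (rep A)) (frag_of A)" "orb ` ?K"]
    by fastforce
  ultimately have f: "Poly_Mapping.keys f \<subseteq> orb ` Per" by blast
  have "orbit_sum f = z"
  proof (rule poly_mapping_eqI)
    fix x show "Poly_Mapping.lookup (orbit_sum f) x = Poly_Mapping.lookup z x"
    proof (cases "x \<in> X")
      case True
      have "Poly_Mapping.lookup f (orb x)
          = (\<Sum>A \<in> orb ` ?K. if A = orb x then Poly_Mapping.lookup z (rep A) else 0)"
        unfolding f_def lookup_sum by (rule sum.cong) auto
      also have "\<dots> = (if orb x \<in> orb ` ?K then Poly_Mapping.lookup z (rep (orb x)) else 0)"
        by simp
      also have "\<dots> = Poly_Mapping.lookup z x"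
        using const[OF True rep_mem[OF True]] by (auto simp: in_keys_iff)
      finally show ?thesis using lookup_orbit_sum[OF f True] by simp
    next
      case False
      have "Poly_Mapping.keys (orbit_sum f) \<subseteq> X" using hom_in_carrier[OF hom_orbit_sum, of f] f by simp
      then show ?thesis using False z(1) by (metis in_keys_iff subsetD)
    qed
  qed
  then show ?thesis using f by auto
qed

lemma iso_invariants:
  "orbit_sum \<in> iso (free_Abelian_group (orb ` Per))
     (invariant_subgroup integer_group (free_Abelian_group X) (linear_act T))"
proof -
  let ?M = "free_Abelian_group X"
  let ?I = "{z \<in> carrier ?M. \<forall>g \<in> carrier integer_group. linear_act T g z = z}"
  have "subgroup ?I ?M"
    by (rule subgroup_free_Abelian_groupI) (auto simp: linear_act_def frag_extend_diff dest!: subsetD[OF keys_diff])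
  then have c: "carrier (subgroup_generated ?M ?I) = ?I" by (rule subgroup.carrier_subgroup_generated_subgroup)
  have im: "orbit_sum f \<in> ?I" if "f \<in> carrier (free_Abelian_group (orb ` Per))" for f
    using hom_in_carrier[OF hom_orbit_sum that] linear_act_orbit_sum that by simp
  then have hom: "orbit_sum \<in> hom (free_Abelian_group (orb ` Per)) (subgroup_generated ?M ?I)"
    using c by (intro homI) (auto simp: orbit_sum_def frag_extend_add)
  have "inj_on orbit_sum (carrier (free_Abelian_group (orb ` Per)))"
  proof (rule inj_onI)
    fix f g assume "f \<in> carrier (free_Abelian_group (orb ` Per))"
      "g \<in> carrier (free_Abelian_group (orb ` Per))" and eq: "orbit_sum f = orbit_sum g"
    then have "Poly_Mapping.keys (f - g) \<subseteq> orb ` Per" using keys_diff[of f g] by auto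
    moreover have "orbit_sum (f - g) = 0" using eq by (simp add: orbit_sum_def frag_extend_diff)
    ultimately show "f = g" using orbit_sum_eq_0[of "f - g"] by simp
  qed
  moreover have "orbit_sum ` carrier (free_Abelian_group (orb ` Per)) = carrier (subgroup_generated ?M ?I)"
    unfolding c
  proof
    show "?I \<subseteq> orbit_sum ` carrier (free_Abelian_group (orb ` Per))"
    proof
      fix z assume "z \<in> ?I"
      then obtain f where "f \<in> carrier (free_Abelian_group (orb ` Per))" "orbit_sum f = z"
        using invariant_imp_orbit_sum[of z] by auto
      then show "z \<in> orbit_sum ` carrier (free_Abelian_group (orb ` Per))" by blast
    qed
  qed (use im in blast)
  ultimately show ?thesis using hom by (simp add: invariant_subgroup_def iso_def bij_betw_def)
qed

end


section \<open>The action on tuples\<close>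

context small_category
begin

lemma path_cmp_closed:
  "\<lbrakk>u \<in> Obj C; composable C u cs v\<rbrakk> \<Longrightarrow> path_cmp C u cs \<in> Mor C \<and> rng C (path_cmp C u cs) = u"
  by (induction cs arbitrary: u) (auto simp: ident_closed rng_ident cmp_closed rng_cmp src_closed)

lemma composable_take:
  "composable C u cs v \<Longrightarrow> \<exists>w. composable C u (take i cs) w"
proof (induction cs arbitrary: u i)
  case (Cons c cs)
  then obtain w where "composable C (src C c) (take (i - 1) cs) w" by fastforce
  then show ?case using Cons.prems by (cases i) fastforce+
qed (auto intro!: exI)

end

section \<open>The action on tuples in recursive form\<close>

context matched_pair
begin

text \<open>After passing the first entry \<open>d\<close>, the acting element becomes
  \<open>ract c d\<close>. This avoids the partial products in \<open>tuple_act\<close> and suits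
  induction on the tuple.\<close>

fun list_act :: "'c \<Rightarrow> 'd list \<Rightarrow> 'd list" where
  "list_act c [] = []"
| "list_act c (d # ds) = lact c d # list_act (ract c d) ds"

lemma length_list_act: "length (list_act c ds) = length ds"
  by (induction ds arbitrary: c) auto

text \<open>The axiom \<open>ract_cmp\<close> moves the first factor \<open>d\<close> of a partial
  product into the acting element, so the formula for \<open>c\<close> on the tail is the formula
  for \<open>ract c d\<close>. The empty product at the head is an identity, which fixes
  \<open>c\<close> by \<open>ract_ident\<close>.\<close>

lemma list_act_eq:
  assumes "c \<in> Mor C" "composable D (src C c) ds v"
  shows "map (\<lambda>i. lact (ract c (path_cmp D (src C c) (take i ds))) (ds ! i)) [0..<length ds] = list_act c ds"
  using assms
proof (induction ds arbitrary: c)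
  case (Cons d ds)
  have d: "d \<in> Mor D" "rng D d = src C c" "composable D (src D d) ds v" using Cons.prems by auto
  have c': "ract c d \<in> Mor C" "src C (ract c d) = src D d"
    using d Cons.prems(1) by (auto simp: ract_closed src_ract)
  have "ract c (path_cmp D (src C c) (take (Suc i) (d # ds)))
      = ract (ract c d) (path_cmp D (src D d) (take i ds))" for i
  proof -
    obtain w where "composable D (src D d) (take i ds) w" using D.composable_take d(3) by blast
    from D.path_cmp_closed[OF D.src_closed[OF d(1)] this]
    show ?thesis using d Cons.prems(1) by (simp add: ract_cmp)
  qed
  then have "map (\<lambda>i. lact (ract c (path_cmp D (src C c) (take (Suc i) (d # ds)))) ((d # ds) ! Suc i)) [0..<length ds]
      = list_act (ract c d) ds"
    using Cons.IH[OF c'(1)] d(3) c'(2) by simp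
  moreover have "lact (ract c (path_cmp D (src C c) (take 0 (d # ds)))) ((d # ds) ! 0) = lact c d"
    using Cons.prems(1) by (simp add: ract_ident)
  ultimately show ?case by (simp only: length_Cons map_upt_Suc list_act.simps)
qed simp

lemma tuple_act_eq:
  assumes "c \<in> Mor C" "d \<in> tuples_at D q (src C c)"
  shows "tuple_act C D lact ract c d = (rng C c, list_act c (snd d))"
  using assms list_act_eq[OF assms(1)] by (auto simp: tuple_act_def tuples_at_def)

text \<open>By \<open>src_lact\<close> the source of \<open>lact c d\<close> is the range of
  \<open>ract c d\<close>, the element acting on the tail, so consecutive entries still
  match.\<close>

lemma composable_list_act:
  "\<lbrakk>c \<in> Mor C; composable D (src C c) ds v\<rbrakk> \<Longrightarrow> \<exists>w. composable D (rng C c) (list_act c ds) w"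
proof (induction ds arbitrary: c)
  case (Cons d ds)
  then obtain w where "composable D (rng C (ract c d)) (list_act (ract c d) ds) w"
    using ract_closed[of c d] src_ract[of c d] by fastforce
  then have "composable D (rng C c) (list_act c (d # ds)) w"
    using Cons.prems by (simp add: lact_closed rng_lact src_lact)
  then show ?case by blast
qed (auto intro!: exI)

text \<open>On the tail the product acts through \<open>ract (cmp C c1 c2) d\<close>, which
  \<open>cmp_ract\<close> factors as the product of \<open>ract c1 (lact c2 d)\<close> and
  \<open>ract c2 d\<close>; the induction hypothesis applies to these factors.\<close>

lemma list_act_cmp:
  "\<lbrakk>c1 \<in> Mor C; c2 \<in> Mor C; src C c1 = rng C c2; composable D (src C c2) ds v\<rbrakk>
    \<Longrightarrow> list_act (cmp C c1 c2) ds = list_act c1 (list_act c2 ds)"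
proof (induction ds arbitrary: c1 c2)
  case (Cons d ds)
  then have "src C (ract c1 (lact c2 d)) = rng C (ract c2 d)"
    by (simp add: src_ract lact_closed rng_lact src_lact)
  then show ?case using Cons
    by (auto simp: cmp_lact cmp_ract ract_closed lact_closed rng_lact src_ract)
qed simp

lemma list_act_ident:
  "composable D u ds v \<Longrightarrow> list_act (ident C u) ds = ds"
  by (induction ds arbitrary: u) (auto simp: lact_ident ract_on_ident)

lemma tuple_act_closed:
  assumes "c \<in> Mor C" "d \<in> tuples_at D q (src C c)"
  shows "tuple_act C D lact ract c d \<in> tuples_at D q (rng C c)"
  using assms composable_list_act[OF assms(1)] C.rng_closed same_objects
  by (auto simp: tuple_act_eq[OF assms] tuples_at_def length_list_act)

lemma tuple_act_cmp:
  assumes "c1 \<in> Mor C" "c2 \<in> Mor C" "src C c1 = rng C c2" "d \<in> tuples_at D q (src C c2)"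
  shows "tuple_act C D lact ract (cmp C c1 c2) d = tuple_act C D lact ract c1 (tuple_act C D lact ract c2 d)"
proof -
  have "tuple_act C D lact ract c2 d \<in> tuples_at D q (src C c1)"
    using tuple_act_closed[OF assms(2,4)] assms(3) by simp
  moreover have "d \<in> tuples_at D q (src C (cmp C c1 c2))" using assms by (simp add: C.src_cmp)
  ultimately show ?thesis using assms list_act_cmp[OF assms(1-3)]
    by (auto simp: tuple_act_eq C.cmp_closed C.rng_cmp tuples_at_def)
qed

lemma tuple_act_ident:
  assumes "d \<in> tuples_at D q u"
  shows "tuple_act C D lact ract (ident C u) d = d"
proof -
  have u: "u \<in> Obj C" using assms same_objects by (auto simp: tuples_at_def)
  then have "d \<in> tuples_at D q (src C (ident C u))" using assms by (simp add: C.src_ident)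
  then show ?thesis using assms u list_act_ident
    by (auto simp: tuple_act_eq C.ident_closed C.rng_ident tuples_at_def)
qed

end

section \<open>The bundle of integers and its action on tuples\<close>

lemma int_bundle_simps [simp]:
  "Obj (int_bundle U) = U" "Mor (int_bundle U) = U \<times> UNIV" "rng (int_bundle U) = fst"
  "src (int_bundle U) = fst" "ident (int_bundle U) u = (u, 0)"
  "cmp (int_bundle U) c d = (fst c, snd c + snd d)"
  by (simp_all add: int_bundle_def)

locale int_matched_pair = matched_pair "int_bundle (Obj D)" D lact ract
  for D :: "('o, 'd) cat" and lact and ract +
  fixes q :: nat
begin

abbreviation act where "act \<equiv> tuple_act (int_bundle (Obj D)) D lact ract"

text \<open>The fibre is selected by the object of \<open>x\<close>, so the vertex groups at all
  objects combine into one action of the integers on \<open>X\<close>.\<close>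

definition T :: "int \<Rightarrow> 'o \<times> 'd list \<Rightarrow> 'o \<times> 'd list" where "T k x = act (fst x, k) x"

definition X :: "('o \<times> 'd list) set" where "X = (\<Union>u \<in> Obj D. tuples_at D q u)"

lemma int_action_tuples_at: "int_action (tuples_at D q u) T"
proof
  fix x k l assume x: "x \<in> tuples_at D q u"
  then have u: "fst x = u" "u \<in> Obj D" by (auto simp: tuples_at_def)
  show cl: "T k x \<in> tuples_at D q u" for k
    using tuple_act_closed[of "(u, k)" x] x u by (simp add: T_def)
  show "T 0 x = x" using tuple_act_ident[OF x] u by (simp add: T_def)
  have "fst (T l x) = u" using cl[of l] by (auto simp: tuples_at_def)
  then show "T (k + l) x = T k (T l x)"
    using tuple_act_cmp[of "(u, k)" "(u, l)" x q] x u by (simp add: T_def)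
qed

lemma fst_T: "fst (T k x) = fst x"
  by (simp add: T_def tuple_act_def split: prod.split)

sublocale int_action X T
proof
  fix x k l assume "x \<in> X"
  then obtain u where u: "u \<in> Obj D" "x \<in> tuples_at D q u" by (auto simp: X_def)
  then interpret U: int_action "tuples_at D q u" T by (simp add: int_action_tuples_at)
  show "T k x \<in> X" using U.act_closed[OF u(2)] u(1) by (auto simp: X_def)
  show "T 0 x = x" "T (k + l) x = T k (T l x)" using U.act_zero U.act_add u by auto
qed

text \<open>Every morphism of the bundle is a loop, so a composable list stays at one object. The
  condition \<open>u \<in> U\<close> stands under the quantifier because the empty list imposes
  nothing on \<open>u\<close>.\<close>

lemma composable_int_bundle:
  "composable (int_bundle U) u cs v \<longleftrightarrow> u = v \<and> (\<forall>c \<in> set cs. fst c = u \<and> u \<in> U)"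
  by (induction cs arbitrary: u) auto

lemma tuples_eq:
  "tuples (int_bundle (Obj D)) D p q = {(cs, x). x \<in> X \<and> length cs = p \<and> (\<forall>c \<in> set cs. fst c = fst x)}"
  by (auto simp: tuples_def X_def tuples_at_def composable_int_bundle)

end


section \<open>The contraction of the bar complex\<close>

text \<open>The sum of \<open>f i\<close> over \<open>0 \<le> i < a\<close>, continued to negative \<open>a\<close> so that
  \<open>int_sum (a + 1) f - int_sum a f = f a\<close> for every integer \<open>a\<close>.\<close>

definition int_sum :: "int \<Rightarrow> (int \<Rightarrow> 'a::ab_group_add) \<Rightarrow> 'a" where
  "int_sum a f = sum f {0..<a} - sum f {a..<0}"

lemma int_sum_0 [simp]: "int_sum 0 f = 0"
  by (simp add: int_sum_def)

lemma int_sum_Suc: "int_sum (a + 1) f = int_sum a f + f a"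
proof (cases "0 \<le> a")
  case True
  then have "{0..<a + 1} = insert a {0..<a}" by auto
  then show ?thesis using True by (simp add: int_sum_def add.commute)
next
  case False
  then have "{a..<0} = insert a {a + 1..<0}" by auto
  then show ?thesis using False by (simp add: int_sum_def)
qed

text \<open>A function on the integers is determined by its value at 0 and its increments; for
  negative arguments the step equation is solved backwards. The algebraic identities for
  \<open>int_sum\<close> below reduce to this, with no case distinction on signs.\<close>

lemma int_sum_eqI:
  assumes "g 0 = 0" "\<And>a. g (a + 1) = g a + f a"
  shows "int_sum a f = g a"
proof (induction a rule: int_induct[where k = 0])
  case (step2 a)
  then show ?case using int_sum_Suc[of "a - 1" f] assms(2)[of "a - 1"] by simp
qed (use assms int_sum_Suc[of _ f] in auto)

lemma int_sum_telescope: "int_sum a (\<lambda>i. f (i + 1) - f i) = f a - f 0"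
  by (rule int_sum_eqI) auto

lemma int_sum_diff: "int_sum a (\<lambda>i. f i - g i) = int_sum a f - int_sum a g"
  by (rule int_sum_eqI) (auto simp: int_sum_Suc)

text \<open>This is the cocycle rule behind \<open>homotopy_high\<close> and
  \<open>retr_bd\<close>.\<close>

lemma int_sum_split: "int_sum (a + b) f = int_sum b f + int_sum a (\<lambda>i. f (i + b))"
proof -
  have "int_sum a (\<lambda>i. f (i + b)) = int_sum (a + b) f - int_sum b f"
  proof (rule int_sum_eqI)
    fix a
    have "int_sum (a + 1 + b) f = int_sum (a + b) f + f (a + b)"
      using int_sum_Suc[of "a + b" f] by (simp add: algebra_simps)
    then show "int_sum (a + 1 + b) f - int_sum b f = int_sum (a + b) f - int_sum b f + f (a + b)"
      by simp
  qed simp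
  then show ?thesis by simp
qed

lemma frag_extend_int_sum: "frag_extend h (int_sum a f) = int_sum a (\<lambda>i. frag_extend h (f i))"
  by (rule int_sum_eqI[symmetric]) (auto simp: int_sum_Suc frag_extend_add)

lemma keys_int_sum:
  assumes "\<And>i. Poly_Mapping.keys (f i) \<subseteq> S"
  shows "Poly_Mapping.keys (int_sum a f) \<subseteq> S"
  using assms keys_diff[of "sum f {0..<a}" "sum f {a..<0}"] keys_sum[of f] unfolding int_sum_def
  by (smt (verit, best) UN_iff Un_iff subset_eq)

type_synonym ('o, 'd) gen = "('o \<times> int) list \<times> 'o \<times> 'd list"

type_synonym ('o, 'd) chain = "('o, 'd) gen \<Rightarrow>\<^sub>0 int"

section \<open>The bar complex described by prepending entries\<close>

context int_matched_pair
begin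

abbreviation Y :: "nat \<Rightarrow> ('o, 'd) gen set" where
  "Y p \<equiv> tuples (int_bundle (Obj D)) D p q"

abbreviation bd where "bd \<equiv> row_boundary (int_bundle (Obj D)) D lact ract"

text \<open>The object of the new entry is read off from the tuple, so only an integer has to be
  supplied.\<close>

definition pre :: "int \<Rightarrow> ('o, 'd) gen \<Rightarrow> ('o, 'd) gen" where
  "pre a y = ((fst (snd y), a) # fst y, snd y)"

definition Pre :: "int \<Rightarrow> ('o, 'd) chain \<Rightarrow> ('o, 'd) chain" where
  "Pre a = frag_extend (\<lambda>y. frag_of (pre a y))"

text \<open>\<open>faces a cs x\<close> collects all faces of \<open>[a, cs; x]\<close> but the first one, with the opposite sign, so that the
  boundary of \<open>[a, cs; x]\<close> is \<open>[cs; x] - faces a cs x\<close>. Unlike the boundary it satisfies a recursion,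
  and it defines an action of the integers on the chains (\<open>Faces_add\<close>), which is why \<open>d\<^sup>2 = 0\<close>.\<close>

fun faces :: "int \<Rightarrow> ('o \<times> int) list \<Rightarrow> 'o \<times> 'd list \<Rightarrow> ('o, 'd) chain" where
  "faces a [] x = frag_of ([], T a x)"
| "faces a (c # cs) x = frag_of (pre (a + snd c) (cs, x)) - Pre a (faces (snd c) cs x)"

definition Faces :: "int \<Rightarrow> ('o, 'd) chain \<Rightarrow> ('o, 'd) chain" where
  "Faces a = frag_extend (\<lambda>(cs, x). faces a cs x)"

lemma Pre_simps [simp]:
  "Pre a (frag_of y) = frag_of (pre a y)" "Pre a 0 = 0"
  "Pre a (- z) = - Pre a z" "Pre a (z - w) = Pre a z - Pre a w" "Pre a (z + w) = Pre a z + Pre a w"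
  by (simp_all add: Pre_def frag_extend_minus frag_extend_diff frag_extend_add)

lemma Faces_simps [simp]:
  "Faces a 0 = 0" "Faces a (frag_of ([], x)) = frag_of ([], T a x)"
  "Faces a (z - w) = Faces a z - Faces a w" "Faces a (z + w) = Faces a z + Faces a w"
  by (simp_all add: Faces_def frag_extend_diff frag_extend_add)

text \<open>The recursion of \<open>faces\<close> in operator form. Together with
  \<open>bd_Pre\<close> it turns the calculations with boundaries into algebra with
  \<open>Pre\<close> and \<open>Faces\<close>.\<close>

lemma Faces_Pre: "Faces a (Pre b z) = Pre (a + b) z - Pre a (Faces b z)"
  using subset_UNIV[of "Poly_Mapping.keys z"]
proof (induction z rule: frag_induction)
  case (one y)
  show ?case by (cases y) (simp add: Faces_def pre_def)
qed auto

lemma bd_diff: "bd p (z - w) = bd p z - bd p w"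
  by (simp add: row_boundary_def frag_extend_diff)

lemma bd_0: "bd p 0 = 0"
  by (simp add: row_boundary_def)

lemma Y_Suc: "Y (Suc p) = {pre a y |a y. y \<in> Y p}"
proof -
  have ex: "\<exists>a y. (cs, x) = pre a y \<and> y \<in> Y p" if "(cs, x) \<in> Y (Suc p)" for cs x
  proof (cases cs)
    case Nil
    then show ?thesis using that by (simp add: tuples_eq)
  next
    case (Cons c cs')
    then show ?thesis using that
      by (intro exI[of _ "snd c"] exI[of _ "(cs', x)"]) (auto simp: tuples_eq pre_def prod_eq_iff)
  qed
  have "pre a y \<in> Y (Suc p)" if "y \<in> Y p" for a y
    using that by (cases y) (simp add: tuples_eq pre_def)
  then have "{pre a y |a y. y \<in> Y p} \<subseteq> Y (Suc p)" by blast
  moreover have "z \<in> {pre a y |a y. y \<in> Y p}" if "z \<in> Y (Suc p)" for z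
    using ex[of "fst z" "snd z"] that by simp
  ultimately show ?thesis by blast
qed

lemma pre_closed: "y \<in> Y p \<Longrightarrow> pre a y \<in> Y (Suc p)"
  unfolding Y_Suc by blast

lemma Y_0: "Y 0 = Pair [] ` X"
  by (auto simp: tuples_eq)

lemma Pre_closed: "Poly_Mapping.keys z \<subseteq> Y p \<Longrightarrow> Poly_Mapping.keys (Pre a z) \<subseteq> Y (Suc p)"
  using hom_in_carrier[OF hom_frag_extend[of "Y p" "\<lambda>y. frag_of (pre a y)" "Y (Suc p)"], of z]
  by (auto simp: Pre_def Y_Suc)

lemma faces_closed:
  "(cs, x) \<in> Y p \<Longrightarrow> Poly_Mapping.keys (faces a cs x) \<subseteq> Y p"
proof (induction cs arbitrary: a p)
  case Nil
  then show ?case by (auto simp: tuples_eq act_closed)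
next
  case (Cons c cs)
  then obtain n where n: "p = Suc n" "(cs, x) \<in> Y n" by (cases p) (auto simp: tuples_eq)
  then have "Poly_Mapping.keys (Pre a (faces (snd c) cs x)) \<subseteq> Y p"
    using Pre_closed Cons.IH by simp
  moreover have "Poly_Mapping.keys (frag_of (pre (a + snd c) (cs, x))) \<subseteq> Y p" using n pre_closed by simp
  ultimately show ?case by (simp add: keys_diff_subset)
qed

lemma Faces_closed: "Poly_Mapping.keys z \<subseteq> Y p \<Longrightarrow> Poly_Mapping.keys (Faces a z) \<subseteq> Y p"
  using hom_in_carrier[OF hom_frag_extend[of "Y p" "\<lambda>(cs, x). faces a cs x" "Y p"], of z] faces_closed
  by (auto simp: Faces_def)

text \<open>Here the alternating sum meets the recursion. The first multiplication joins
  \<open>c\<close> to the next entry; every later face, the last one included, arises from a face of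
  the tail by prepending \<open>c\<close>, with its sign reversed by the index shift.\<close>

lemma boundary_tail:
  assumes "fst c = fst x" "\<forall>b \<in> set cs. fst b = fst x" "length cs = p"
  shows "(\<Sum>i=1..p. frag_cmul ((-1) ^ i) (frag_of (take (i - 1) (c # cs) @
        [cmp (int_bundle (Obj D)) ((c # cs) ! (i - 1)) ((c # cs) ! i)] @ drop (i + 1) (c # cs), x)))
      + frag_cmul ((-1) ^ (p + 1)) (frag_of (butlast (c # cs), act (last (c # cs)) x))
    = - faces (snd c) cs x"
  using assms
proof (induction cs arbitrary: c p)
  case Nil
  then have "T (snd c) x = act c x" by (metis T_def prod.collapse)
  then show ?case using Nil by simp
next
  case (Cons b cs)
  define n where "n = length cs"
  define t where "t i = frag_of (take (i - 1) (b # cs) @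
        [cmp (int_bundle (Obj D)) ((b # cs) ! (i - 1)) ((b # cs) ! i)] @ drop (i + 1) (b # cs), x)" for i
  define s where "s i = frag_of (take (i - 1) (c # b # cs) @
        [cmp (int_bundle (Obj D)) ((c # b # cs) ! (i - 1)) ((c # b # cs) ! i)] @ drop (i + 1) (c # b # cs), x)" for i
  let ?l = "frag_of (butlast (b # cs), act (last (b # cs)) x)"
  have p: "p = Suc n" using Cons.prems n_def by simp
  have IH: "(\<Sum>i=1..n. frag_cmul ((-1) ^ i) (t i)) + frag_cmul ((-1) ^ (n + 1)) ?l = - faces (snd b) cs x"
    unfolding t_def by (rule Cons.IH) (use Cons.prems n_def in auto)
  have cc: "c # zs = (fst x, snd c) # zs" for zs using Cons.prems by (cases c) auto
  have st: "s (Suc i) = Pre (snd c) (t i)" if "1 \<le> i" for i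
    using that by (cases i) (auto simp: s_def t_def pre_def cc)
  have s1: "s 1 = frag_of (pre (snd c + snd b) (cs, x))"
    using Cons.prems by (simp add: s_def pre_def)
  have l: "frag_of (butlast (c # b # cs), act (last (c # b # cs)) x) = Pre (snd c) ?l"
  proof -
    \<comment> \<open>The action keeps the object of \<open>x\<close>, so prepending to the last
      face of the tail inserts the same entry \<open>c\<close>.\<close>
    have "fst (last (b # cs)) = fst x" using Cons.prems(1,2) last_in_set[of "b # cs"] by blast
    then have "fst (act (last (b # cs)) x) = fst x" by (simp add: tuple_act_def split: prod.split)
    moreover have "last (c # b # cs) = last (b # cs)" "butlast (c # b # cs) = (fst x, snd c) # butlast (b # cs)"
      using cc by simp_all
    ultimately show ?thesis by (simp only: Pre_simps pre_def fst_conv snd_conv)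
  qed
  have l': "frag_cmul ((-1) ^ (p + 1)) (Pre (snd c) ?l) = - Pre (snd c) (frag_cmul ((-1) ^ (n + 1)) ?l)"
    by (simp add: p Pre_def frag_extend_cmul)
  have IH': "Pre (snd c) (\<Sum>i=1..n. frag_cmul ((-1) ^ i) (t i)) + Pre (snd c) (frag_cmul ((-1) ^ (n + 1)) ?l)
      = - Pre (snd c) (faces (snd b) cs x)"
    unfolding Pre_simps(5)[symmetric] IH by simp
  \<comment> \<open>The face with index 1 is split off and the others are shifted down by
    one.\<close>
  have "(\<Sum>i=1..p. frag_cmul ((-1) ^ i) (s i)) = - s 1 + (\<Sum>i=1..n. frag_cmul ((-1) ^ Suc i) (s (Suc i)))"
    unfolding p by (subst sum.atLeast_Suc_atMost) (simp, simp only: sum.atLeast_Suc_atMost_Suc_shift o_def, simp)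
  also have "(\<Sum>i=1..n. frag_cmul ((-1) ^ Suc i) (s (Suc i))) = - Pre (snd c) (\<Sum>i=1..n. frag_cmul ((-1) ^ i) (t i))"
    by (simp add: Pre_def frag_extend_sum frag_extend_cmul st o_def sum_negf[symmetric] flip: minus_frag_cmul)
  finally have S: "(\<Sum>i=1..p. frag_cmul ((-1) ^ i) (s i))
      = - s 1 + - Pre (snd c) (\<Sum>i=1..n. frag_cmul ((-1) ^ i) (t i))" .
  have F: "Pre (snd c) (faces (snd b) cs x) = - (Pre (snd c) (\<Sum>i=1..n. frag_cmul ((-1) ^ i) (t i))
      + Pre (snd c) (frag_cmul ((-1) ^ (n + 1)) ?l))"
    unfolding IH' by (rule minus_minus[symmetric])
  show ?case unfolding s_def[symmetric] l l' S s1 faces.simps F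
    by (simp only: diff_conv_add_uminus minus_add_distrib minus_minus ac_simps)
qed

lemma bd_pre:
  assumes "y \<in> Y p"
  shows "bd p (frag_of (pre a y)) = frag_of y - Faces a (frag_of y)"
proof -
  obtain cs x where y: "y = (cs, x)" by (cases y)
  then have "\<forall>b \<in> set cs. fst b = fst x" "length cs = p" using assms by (auto simp: tuples_eq)
  from boundary_tail[of "(fst x, a)" x, OF _ this] show ?thesis
    unfolding row_boundary_def Faces_def y by (simp add: pre_def add.assoc)
qed

lemma bd_Pre:
  assumes "Poly_Mapping.keys z \<subseteq> Y p"
  shows "bd p (Pre a z) = z - Faces a z"
  using assms by (induction z rule: frag_induction) (auto simp: bd_0 bd_diff bd_pre)

lemma bd_closed:
  assumes "Poly_Mapping.keys z \<subseteq> Y (Suc p)"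
  shows "Poly_Mapping.keys (bd p z) \<subseteq> Y p"
  using assms
proof (induction z rule: frag_induction)
  case (one y')
  then obtain a y where y: "y' = pre a y" "y \<in> Y p" by (auto simp: Y_Suc)
  then show ?case using Faces_closed[of "frag_of y" p a] by (simp add: bd_pre keys_diff_subset)
qed (simp_all add: bd_0 bd_diff keys_diff_subset)

text \<open>In positive degree, applying \<open>Faces a\<close> to both terms of the recursion
  creates two additional terms beginning with \<open>Pre a\<close>, which cancel by the induction
  hypothesis. In degree 0 this is the action law of \<open>T\<close>.\<close>

lemma Faces_add:
  assumes "Poly_Mapping.keys z \<subseteq> Y p"
  shows "Faces a (Faces b z) = Faces (a + b) z"
  using assms
proof (induction z rule: frag_induction)
  case (one y)
  obtain cs x where y: "y = (cs, x)" by (cases y)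
  then have "x \<in> X" using one by (auto simp: tuples_eq)
  have "Faces a (faces b cs x) = faces (a + b) cs x" for a b
  proof (induction cs arbitrary: a b)
    case Nil
    then show ?case using \<open>x \<in> X\<close> by (simp add: act_add)
  next
    case (Cons c cs)
    show ?case using Faces_Pre[of a "b + snd c" "frag_of (cs, x)"]
      by (simp add: Faces_Pre Cons add.assoc) (simp add: Faces_def)
  qed
  then show ?case by (simp add: Faces_def y)
qed auto

text \<open>On \<open>Pre a (Pre b w)\<close> everything cancels except
  \<open>Faces (a + b) w - Faces a (Faces b w)\<close>, which vanishes by
  \<open>Faces_add\<close>.\<close>

lemma bd_bd:
  assumes "Poly_Mapping.keys z \<subseteq> Y (Suc (Suc p))"
  shows "bd p (bd (Suc p) z) = 0"
  using assms
proof (induction z rule: frag_induction)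
  case (one z)
  then obtain a b y where z: "frag_of z = Pre a (Pre b (frag_of y))" and y: "y \<in> Y p" by (auto simp: Y_Suc)
  have k: "Poly_Mapping.keys (frag_of y) \<subseteq> Y p" using y by simp
  have k': "Poly_Mapping.keys (Pre b (frag_of y)) \<subseteq> Y (Suc p)" using Pre_closed[OF k] .
  have "bd (Suc p) (frag_of z) = Pre b (frag_of y) - (Pre (a + b) (frag_of y) - Pre a (Faces b (frag_of y)))"
    unfolding z bd_Pre[OF k'] Faces_Pre ..
  then show ?case
    by (simp only: bd_diff bd_Pre[OF k] bd_Pre[OF Faces_closed[OF k]] Faces_add[OF k]) simp
qed (auto simp: bd_0 bd_diff)

section \<open>The contracting homotopy\<close>

text \<open>Intended for positive degree, where \<open>hd\<close> is meaningful. The sum alone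
  contributes \<open>Pre a z - Pre 0 z\<close> by telescoping; the term with two zeros compensates
  the degenerate chain \<open>Pre 0 z\<close>, which is still present in the unnormalized
  complex.\<close>

definition htpy :: "('o, 'd) chain \<Rightarrow> ('o, 'd) chain" where
  "htpy = frag_extend (\<lambda>(cs, x). Pre 0 (Pre 0 (frag_of (tl cs, x)))
     - int_sum (snd (hd cs)) (\<lambda>i. Pre 1 (Pre i (frag_of (tl cs, x)))))"

lemma htpy_simps [simp]: "htpy 0 = 0" "htpy (z - w) = htpy z - htpy w"
  by (simp_all add: htpy_def frag_extend_diff)

lemma htpy_Pre: "htpy (Pre a z) = Pre 0 (Pre 0 z) - int_sum a (\<lambda>i. Pre 1 (Pre i z))"
  using subset_UNIV[of "Poly_Mapping.keys z"]
proof (induction z rule: frag_induction)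
  case zero
  \<comment> \<open>Telescoping a constant function shows that \<open>int_sum\<close> of the zero
    function is 0.\<close>
  show ?case using int_sum_telescope[of a "\<lambda>_. 0"] by simp
next
  case (one y)
  show ?case by (simp add: htpy_def pre_def)
next
  case (diff z w)
  then show ?case by (simp add: int_sum_diff)
qed

lemma htpy_closed:
  assumes "Poly_Mapping.keys z \<subseteq> Y (Suc p)"
  shows "Poly_Mapping.keys (htpy z) \<subseteq> Y (Suc (Suc p))"
  using assms
proof (induction z rule: frag_induction)
  case (one z)
  then obtain a y where z: "frag_of z = Pre a (frag_of y)" and y: "y \<in> Y p" by (auto simp: Y_Suc)
  show ?case unfolding z htpy_Pre using y
    by (intro keys_diff_subset keys_int_sum Pre_closed) auto
qed (simp_all add: keys_diff_subset)

text \<open>The boundary of \<open>Pre 1 (Pre i z)\<close> contains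
  \<open>Pre i z - Pre (i + 1) z\<close>, which telescopes over \<open>i\<close>.\<close>

lemma bd_htpy_Pre:
  assumes z: "Poly_Mapping.keys z \<subseteq> Y p"
  shows "bd (Suc p) (htpy (Pre a z))
    = Pre 0 (Faces 0 z) - Pre 0 z + Pre a z - int_sum a (\<lambda>i. Pre 1 (Faces i z))"
proof -
  have k: "bd (Suc p) (Pre b (Pre i z)) = Pre i z - (Pre (b + i) z - Pre b (Faces i z))" for b i
    unfolding bd_Pre[OF Pre_closed[OF z]] Faces_Pre ..
  have "bd (Suc p) (int_sum a (\<lambda>i. Pre 1 (Pre i z)))
      = int_sum a (\<lambda>i. Pre 1 (Faces i z) - (Pre (i + 1) z - Pre i z))"
    unfolding row_boundary_def frag_extend_int_sum unfolding row_boundary_def[symmetric] k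
    by (simp add: algebra_simps)
  also have "\<dots> = int_sum a (\<lambda>i. Pre 1 (Faces i z)) - (Pre a z - Pre 0 z)"
    using int_sum_telescope[of a "\<lambda>i. Pre i z"] by (simp add: int_sum_diff)
  finally show ?thesis unfolding htpy_Pre bd_diff k by simp
qed

text \<open>For a chain \<open>Pre a (Pre b w)\<close> the terms in \<open>Faces b w\<close> cancel
  between the two summands. The remaining sums have lengths \<open>a + b\<close>, \<open>b\<close>
  and \<open>a\<close>, the last one shifted by \<open>b\<close>, and cancel by
  \<open>int_sum_split\<close>.\<close>

lemma homotopy_high:
  assumes "Poly_Mapping.keys z \<subseteq> Y (Suc (Suc p))"
  shows "bd (Suc (Suc p)) (htpy z) + htpy (bd (Suc p) z) = z"
  using assms
proof (induction z rule: frag_induction)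
  case (one z)
  then obtain a b y where z: "frag_of z = Pre a (Pre b (frag_of y))" and y: "y \<in> Y p" by (auto simp: Y_Suc)
  define w where "w = frag_of y"
  have k: "Poly_Mapping.keys (Pre b w) \<subseteq> Y (Suc p)" using y by (intro Pre_closed) (simp add: w_def)
  show ?case unfolding z w_def[symmetric] bd_htpy_Pre[OF k] bd_Pre[OF k]
    by (simp add: Faces_Pre htpy_Pre int_sum_diff int_sum_split[of a b] add.commute)
next
  case (diff z w)
  have "bd (Suc (Suc p)) (htpy (z - w)) + htpy (bd (Suc p) (z - w))
      = (bd (Suc (Suc p)) (htpy z) + htpy (bd (Suc p) z)) - (bd (Suc (Suc p)) (htpy w) + htpy (bd (Suc p) w))"
    by (simp add: bd_diff)
  then show ?case unfolding diff .
qed (simp add: bd_0)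

section \<open>Comparison with the two-term complex\<close>

definition emb :: "('o \<times> 'd list \<Rightarrow>\<^sub>0 int) \<Rightarrow> ('o, 'd) chain" where
  "emb = frag_extend (\<lambda>x. frag_of ([], x))"

text \<open>With \<open>t\<close> the action of 1, the inner sum is
  \<open>(t^a - 1) / (t - 1)\<close> applied to \<open>x\<close>, for either sign of
  \<open>a\<close>.\<close>

definition retr :: "('o, 'd) chain \<Rightarrow> ('o \<times> 'd list \<Rightarrow>\<^sub>0 int)" where
  "retr = frag_extend (\<lambda>(cs, x). int_sum (snd (hd cs)) (\<lambda>i. frag_of (T i x)))"

lemma emb_simps [simp]: "emb 0 = 0" "emb (frag_of x) = frag_of ([], x)" "emb (z - w) = emb z - emb w"
  by (simp_all add: emb_def frag_extend_diff)

lemma retr_simps [simp]: "retr 0 = 0" "retr (frag_of (pre a ([], x))) = int_sum a (\<lambda>i. frag_of (T i x))"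
  "retr (z - w) = retr z - retr w"
  by (simp_all add: retr_def pre_def frag_extend_diff)

lemma emb_eq_0: "emb w = 0 \<Longrightarrow> w = 0"
proof -
  have "frag_extend (\<lambda>y. frag_of (snd y)) (emb w) = w"
    using subset_UNIV[of "Poly_Mapping.keys w"]
    by (induction w rule: frag_induction) (auto simp: frag_extend_diff)
  then show "emb w = 0 \<Longrightarrow> w = 0" by simp
qed

lemma emb_closed: "Poly_Mapping.keys w \<subseteq> X \<Longrightarrow> Poly_Mapping.keys (emb w) \<subseteq> Y 0"
  by (induction w rule: frag_induction) (simp_all add: Y_0 keys_diff_subset)

lemma Faces_emb: "Faces a (emb w) = emb (linear_act T a w)"
  using subset_UNIV[of "Poly_Mapping.keys w"]
  by (induction w rule: frag_induction) (auto simp: linear_act_def frag_extend_diff)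

lemma Y_1: "z \<in> Y 1 \<Longrightarrow> \<exists>a x. x \<in> X \<and> z = pre a ([], x)"
  by (auto simp: Y_Suc Y_0)

lemma retr_closed: "Poly_Mapping.keys z \<subseteq> Y 1 \<Longrightarrow> Poly_Mapping.keys (retr z) \<subseteq> X"
proof (induction z rule: frag_induction)
  case (one z)
  then obtain a x where "z = pre a ([], x)" "x \<in> X" using Y_1 by blast
  then show ?case by (simp add: keys_int_sum act_closed)
qed (simp_all add: keys_diff_subset)

text \<open>Over degree 0 the operator \<open>Faces 0\<close> is the identity, so the degenerate
  terms of \<open>bd_htpy_Pre\<close> cancel and the remaining sum is the retraction, prefixed by 1.
  Hence \<open>z\<close> differs from \<open>Pre 1 (emb (retr z))\<close> by a boundary.\<close>

lemma homotopy_1: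
  assumes "Poly_Mapping.keys z \<subseteq> Y 1"
  shows "bd 1 (htpy z) = z - Pre 1 (emb (retr z))"
  using assms
proof (induction z rule: frag_induction)
  case (one z)
  then obtain a x where z: "z = pre a ([], x)" "x \<in> X" using Y_1 by blast
  have "Poly_Mapping.keys (frag_of ([], x)) \<subseteq> Y 0" using z by (simp add: Y_0)
  from bd_htpy_Pre[OF this, of a] show ?case using z
    by (simp add: act_zero emb_def Pre_def frag_extend_int_sum)
qed (auto simp: bd_0 bd_diff)

text \<open>This is the geometric sum \<open>(1 - t) (1 + ... + t^(a-1)) = 1 - t^a\<close>. It makes
  a chain of degree 1 a cycle exactly if its retraction is invariant.\<close>

lemma bd_0_retr:
  assumes "Poly_Mapping.keys z \<subseteq> Y 1"
  shows "bd 0 z = emb (retr z - linear_act T 1 (retr z))"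
  using assms
proof (induction z rule: frag_induction)
  case (one z)
  then obtain a x where z: "z = pre a ([], x)" "x \<in> X" using Y_1 by blast
  have "linear_act T 1 (int_sum a (\<lambda>i. frag_of (T i x))) = int_sum a (\<lambda>i. frag_of (T (i + 1) x))"
    using z(2) by (simp add: linear_act_def frag_extend_int_sum add.commute flip: act_add)
  moreover have "int_sum a (\<lambda>i. frag_of (T (i + 1) x)) - int_sum a (\<lambda>i. frag_of (T i x))
      = frag_of (T a x) - frag_of x"
    using int_sum_telescope[of a "\<lambda>i. frag_of (T i x)"] z(2) by (simp add: int_sum_diff act_zero)
  ultimately have "retr (frag_of z) - linear_act T 1 (retr (frag_of z)) = frag_of x - frag_of (T a x)"
    using z(1) by (simp add: algebra_simps)
  then show ?case using z by (simp add: bd_pre Y_0)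
qed (auto simp: bd_0 bd_diff linear_act_def frag_extend_diff)

text \<open>On a generator with entries \<open>a\<close> and \<open>b\<close> the three terms cancel
  by the cocycle rule \<open>int_sum_split\<close>.\<close>

lemma retr_bd:
  assumes "Poly_Mapping.keys z \<subseteq> Y 2"
  shows "retr (bd 1 z) = 0"
  using assms
proof (induction z rule: frag_induction)
  case (one z)
  then obtain a y where "z = pre a y" and "y \<in> Y 1"
    using Y_Suc[of 1] by (auto simp: numeral_2_eq_2)
  moreover obtain b x where "y = pre b ([], x)" and x: "x \<in> X" using Y_1 \<open>y \<in> Y 1\<close> by blast
  ultimately have z: "z = pre a (pre b ([], x))" and y: "pre b ([], x) \<in> Y 1" by simp_all
  have F: "Faces a (frag_of (pre b ([], x))) = frag_of (pre (a + b) ([], x)) - frag_of (pre a ([], T b x))"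
    using Faces_Pre[of a b "frag_of ([], x)"] by simp
  have "retr (bd 1 (frag_of z)) = int_sum b (\<lambda>i. frag_of (T i x))
     - (int_sum (a + b) (\<lambda>i. frag_of (T i x)) - int_sum a (\<lambda>i. frag_of (T i (T b x))))"
    unfolding z bd_pre[OF y] F by simp
  then show ?case using x by (simp add: int_sum_split[of a b] act_add)
qed (auto simp: bd_0 bd_diff)

lemma retr_Pre_emb:
  assumes "Poly_Mapping.keys w \<subseteq> X"
  shows "retr (Pre 1 (emb w)) = w"
  using assms
proof (induction w rule: frag_induction)
  case (one x)
  then show ?case using int_sum_Suc[of 0 "\<lambda>i. frag_of (T i x)"] by (simp add: act_zero)
qed auto

end


section \<open>Homology\<close>

text \<open>For disjoint bases the direct sum is the free group on the union, by adding up the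
  components; an element of a single summand is thereby sent to itself.\<close>

lemma iso_from_sum_free_Abelian_groups:
  assumes disj: "pairwise (\<lambda>i j. disjnt (S i) (S j)) I"
    and \<alpha>': "\<alpha>' \<in> iso (free_Abelian_group (\<Union>(S ` I))) H"
  shows "\<exists>\<alpha> \<in> iso (sum_group I (\<lambda>i. free_Abelian_group (S i))) H.
    \<forall>i \<in> I. \<forall>x. \<alpha> (sum_inj I (\<lambda>i. free_Abelian_group (S i)) i x) = \<alpha>' x"
proof (intro bexI ballI allI)
  show "\<alpha>' \<circ> (\<lambda>f. sum' f I) \<in> iso (sum_group I (\<lambda>i. free_Abelian_group (S i))) H"
    by (rule iso_set_trans[OF iso_free_Abelian_group_sum[OF disj] \<alpha>'])
  fix i x assume i: "i \<in> I"
  let ?g = "sum_inj I (\<lambda>i. free_Abelian_group (S i)) i x"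
  have "sum' ?g I = sum' ?g {i}"
    using i by (intro sum.mono_neutral_right') (auto simp: sum_inj_def)
  also have "\<dots> = x" using i by (simp add: sum_inj_def)
  finally show "(\<alpha>' \<circ> (\<lambda>f. sum' f I)) ?g = \<alpha>' x" by simp
qed

context int_matched_pair
begin

abbreviation Ch where "Ch p \<equiv> row_chain (int_bundle (Obj D)) D p q"
abbreviation Im where "Im p \<equiv> row_image (int_bundle (Obj D)) D lact ract p q"
abbreviation Cyc where "Cyc p \<equiv> row_cycles (int_bundle (Obj D)) D lact ract p q"
abbreviation Hom where "Hom p \<equiv> row_homology (int_bundle (Obj D)) D lact ract p q"

lemma hom_bd: "bd p \<in> hom (Ch (Suc p)) (Ch p)"
  using bd_closed by (intro homI) (auto simp: row_chain_def row_boundary_def frag_extend_add)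

lemma group_hom_bd: "group_hom (Ch (Suc p)) (Ch p) (bd p)"
  using hom_bd by (simp add: group_hom_def group_hom_axioms_def row_chain_def)

lemma subgroup_Im: "subgroup (Im p) (Ch p)"
  unfolding row_image_def using group_hom_bd by (rule group_hom.img_is_subgroup)

lemma subgroup_Cyc_Suc: "subgroup (Cyc (Suc p)) (Ch (Suc p))"
  unfolding row_cycles_def nat.case using group_hom_bd by (rule group_hom.subgroup_kernel)

lemma Cyc_Suc: "Cyc (Suc p) = {z. Poly_Mapping.keys z \<subseteq> Y (Suc p) \<and> bd p z = 0}"
  by (auto simp: row_cycles_def kernel_def row_chain_def)

lemma Im_eq: "Im p = {bd p z |z. Poly_Mapping.keys z \<subseteq> Y (Suc p)}"
  by (auto simp: row_image_def row_chain_def)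

lemma Im_subset_Cyc: "Im (Suc p) \<subseteq> Cyc (Suc p)"
  by (auto simp: Im_eq Cyc_Suc bd_bd dest: bd_closed[THEN subsetD])

section \<open>Homology in degree 0, in degree 1 and above\<close>

text \<open>All chains of degree 0 are cycles, and the boundary of \<open>[k; x]\<close> is
  \<open>x - T k x\<close>, so passing to homology identifies the points of each orbit.\<close>

lemma iso_Hom_0:
  "\<exists>\<alpha> \<in> iso (free_Abelian_group (orb ` X)) (Hom 0).
    \<forall>x \<in> X. \<alpha> (frag_of (orb x)) = Im 0 #>\<^bsub>Ch 0\<^esub> frag_of ([], x)"
proof -
  have Ch0: "Ch 0 = free_Abelian_group (Pair [] ` X)" by (simp add: row_chain_def Y_0)
  have Hom0: "Hom 0 = Ch 0 Mod Im 0"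
    by (simp add: row_homology_def row_cycles_def row_chain_def group.subgroup_generated_group_carrier)
  have sub: "subgroup (Im 0) (free_Abelian_group (Pair [] ` X))" using subgroup_Im[of 0] by (simp add: Ch0)
  have bd: "bd 0 (frag_of (pre a ([], x))) = frag_of ([], x) - frag_of ([], T a x)" if "x \<in> X" for a x
    using bd_pre[of "([], x)" 0 a] that by (simp add: Y_0)
  show ?thesis unfolding Hom0 Ch0
  proof (rule iso_orbit_classes[where p = snd, OF _ sub])
    fix x k assume x: "x \<in> X"
    then have "pre k ([], x) \<in> Y (Suc 0)" by (intro pre_closed) (simp add: Y_0)
    then have "bd 0 (frag_of (pre k ([], x))) \<in> Im 0" unfolding Im_eq by (auto intro!: exI)
    then show "frag_of ([], x) - frag_of ([], T k x) \<in> Im 0" using bd[OF x] by simp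
  next
    fix b assume "b \<in> Im 0"
    then obtain z where z: "Poly_Mapping.keys z \<subseteq> Y 1" "b = bd 0 z" by (auto simp: Im_eq)
    from z(1) show "frag_extend (\<lambda>y. frag_of (orb (snd y))) b = 0" unfolding z(2)
    proof (induction z rule: frag_induction)
      case (one z)
      then obtain a x where "z = pre a ([], x)" "x \<in> X" using Y_1 by blast
      then show ?case by (simp add: bd frag_extend_diff orb_act)
    qed (simp_all add: bd_0 bd_diff frag_extend_diff)
  qed simp
qed

lemma Pre_emb_orbit_sum:
  assumes "x \<in> Per"
  shows "Pre 1 (emb (orbit_sum (frag_of (orb x)))) = (\<Sum>y\<in>orb x. frag_of ([(fst y, 1)], y))"
  using assms by (simp add: Per_def orbit_sum_def emb_def Pre_def frag_extend_sum pre_def o_def)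

text \<open>Since \<open>retr\<close> kills boundaries and undoes \<open>Pre 1\<close> after
  \<open>emb\<close>, an orbit sum that becomes a boundary is 0. Conversely, the retraction of a
  cycle \<open>z\<close> is invariant, hence an orbit sum, and the difference is the boundary of
  \<open>htpy z\<close>.\<close>

lemma iso_Hom_1:
  "\<exists>\<alpha> \<in> iso (free_Abelian_group (orb ` Per)) (Hom 1).
    \<forall>x \<in> Per. \<alpha> (frag_of (orb x)) = Im 1 #>\<^bsub>Ch 1\<^esub> (\<Sum>y\<in>orb x. frag_of ([(fst y, 1)], y))"
proof (intro bexI ballI)
  let ?\<beta> = "\<lambda>f. Pre 1 (emb (orbit_sum f))"
  show "Im 1 #>\<^bsub>Ch 1\<^esub> ?\<beta> (frag_of (orb x)) = Im 1 #>\<^bsub>Ch 1\<^esub> (\<Sum>y\<in>orb x. frag_of ([(fst y, 1)], y))"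
    if "x \<in> Per" for x
    using Pre_emb_orbit_sum[OF that] by simp
  interpret comm_group "Ch 1" unfolding row_chain_def by (rule abelian_free_Abelian_group)
  have os: "Poly_Mapping.keys (orbit_sum f) \<subseteq> X" if "Poly_Mapping.keys f \<subseteq> orb ` Per" for f
    using hom_in_carrier[OF hom_orbit_sum, of f] that by simp
  have cl: "Poly_Mapping.keys (?\<beta> f) \<subseteq> Y 1" if "Poly_Mapping.keys f \<subseteq> orb ` Per" for f
    using Pre_closed[OF emb_closed[OF os[OF that]]] by simp
  show "(\<lambda>f. Im 1 #>\<^bsub>Ch 1\<^esub> ?\<beta> f) \<in> iso (free_Abelian_group (orb ` Per)) (Hom 1)"
    unfolding row_homology_def
  proof (rule iso_Mod_of_section)
    show "?\<beta> \<in> hom (free_Abelian_group (orb ` Per)) (Ch 1)"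
      using cl by (intro homI) (auto simp: row_chain_def orbit_sum_def emb_def frag_extend_add)
    show "subgroup (Cyc 1) (Ch 1)" "Im 1 \<subseteq> Cyc 1" "subgroup (Im 1) (Ch 1)"
      using subgroup_Cyc_Suc[of 0] Im_subset_Cyc[of 0] subgroup_Im[of 1] by simp_all
    fix f assume "f \<in> carrier (free_Abelian_group (orb ` Per))"
    then have f: "Poly_Mapping.keys f \<subseteq> orb ` Per" by simp
    have "bd 0 (?\<beta> f) = 0"
      using bd_Pre[OF emb_closed[OF os[OF f]], of 1] linear_act_orbit_sum[OF f] by (simp add: Faces_emb)
    then show "?\<beta> f \<in> Cyc 1" using cl[OF f] Cyc_Suc[of 0] by simp
    assume "?\<beta> f \<in> Im 1"
    then have "retr (?\<beta> f) = 0" using retr_bd by (auto simp: Im_eq numeral_2_eq_2)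
    then show "f = \<one>\<^bsub>free_Abelian_group (orb ` Per)\<^esub>"
      using retr_Pre_emb[OF os[OF f]] orbit_sum_eq_0[OF f] by simp
  next
    fix z assume "z \<in> Cyc 1"
    then have z: "Poly_Mapping.keys z \<subseteq> Y 1" "bd 0 z = 0" using Cyc_Suc[of 0] by simp_all
    have "linear_act T 1 (retr z) = retr z" using bd_0_retr[OF z(1)] z(2) emb_eq_0[of "retr z - linear_act T 1 (retr z)"] by simp
    then obtain f where f: "f \<in> carrier (free_Abelian_group (orb ` Per))" "orbit_sum f = retr z"
      using invariant_imp_orbit_sum[OF retr_closed[OF z(1)]] by blast
    have "bd 1 (htpy z) \<in> Im 1" using htpy_closed[of z 0] z(1) by (auto simp: Im_eq)
    then have "z - ?\<beta> f \<in> Im 1" using homotopy_1[OF z(1)] f(2) by simp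
    then have "z \<otimes>\<^bsub>Ch 1\<^esub> inv\<^bsub>Ch 1\<^esub> ?\<beta> f \<in> Im 1" using cl f(1) by (simp add: row_chain_def)
    then show "\<exists>f \<in> carrier (free_Abelian_group (orb ` Per)). z \<otimes>\<^bsub>Ch 1\<^esub> inv\<^bsub>Ch 1\<^esub> ?\<beta> f \<in> Im 1"
      using f(1) by blast
  qed simp
qed

lemma trivial_Hom:
  assumes "2 \<le> p"
  shows "trivial_group (Hom p)"
proof -
  obtain n where p: "p = Suc (Suc n)" using assms by (metis Suc_le_D numeral_2_eq_2 Suc_le_mono)
  interpret comm_group "Ch p" unfolding row_chain_def by (rule abelian_free_Abelian_group)
  have sub: "subgroup (Cyc p) (Ch p)" "subgroup (Im p) (Ch p)" "Im p \<subseteq> Cyc p"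
    unfolding p by (rule subgroup_Cyc_Suc subgroup_Im Im_subset_Cyc)+
  \<comment> \<open>The empty basis, over an arbitrarily chosen type, gives the trivial group as
    source; surjectivity then says that every cycle is a boundary.\<close>
  have "(\<lambda>f :: bool \<Rightarrow>\<^sub>0 int. Im p #>\<^bsub>Ch p\<^esub> 0) \<in> iso (free_Abelian_group {}) (Hom p)"
    unfolding row_homology_def
  proof (rule iso_Mod_of_section[OF _ _ sub])
    have "0 \<in> Cyc p" using subgroup.one_closed[OF sub(1)] by (simp add: row_chain_def)
    then show "\<And>f. f \<in> carrier (free_Abelian_group ({} :: bool set)) \<Longrightarrow> 0 \<in> Cyc p" .
    show "(\<lambda>f. 0) \<in> hom (free_Abelian_group ({} :: bool set)) (Ch p)"
      by (intro homI) (auto simp: row_chain_def)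
    fix z assume "z \<in> Cyc p"
    then have z: "Poly_Mapping.keys z \<subseteq> Y p" "bd (Suc n) z = 0" unfolding p Cyc_Suc by simp_all
    have "z = bd p (htpy z)" using homotopy_high[of z n] z unfolding p by simp
    moreover have "bd p (htpy z) \<in> Im p" using htpy_closed[of z "Suc n"] z unfolding p Im_eq by blast
    ultimately have "z \<in> Im p" by simp
    then show "\<exists>f \<in> carrier (free_Abelian_group ({} :: bool set)). z \<otimes>\<^bsub>Ch p\<^esub> inv\<^bsub>Ch p\<^esub> 0 \<in> Im p"
      by (intro bexI[of _ 0]) (auto simp: row_chain_def)
  qed auto
  moreover have "group (Hom p)"
    unfolding row_homology_def
  proof (rule normal.factorgroup_is_group)
    have "comm_group (subgroup_generated (Ch p) (Cyc p))"
      by (rule abelian_subgroup_generated) (rule comm_group_axioms)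
    then show "Im p \<lhd> subgroup_generated (Ch p) (Cyc p)"
      using sub by (auto intro: comm_group.normal_iff_subgroup[THEN iffD2] subgroup_of_subgroup_generated)
  qed
  moreover have "trivial_group (free_Abelian_group ({} :: bool set))"
    by (auto simp: trivial_group_def)
  ultimately show ?thesis using isomorphic_group_triviality1 is_isoI by blast
qed

section \<open>Orbits, invariants and coinvariants at a single object\<close>

lemma Union_orb: "(\<Union>u \<in> Obj D. orb ` tuples_at D q u) = orb ` X"
  by (auto simp: X_def)

lemma Union_orb_Per: "(\<Union>u \<in> Obj D. orb ` {x \<in> tuples_at D q u. finite (orb x)}) = orb ` Per"
  unfolding Per_def unfolding X_def by auto

text \<open>The action preserves the object of a tuple, so an orbit determines its object. Allowing
  subsets \<open>S u\<close> covers the periodic points too.\<close>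

lemma disjnt_orbits:
  assumes "\<And>u. S u \<subseteq> tuples_at D q u"
  shows "pairwise (\<lambda>u v. disjnt (orb ` S u) (orb ` S v)) U"
proof -
  have "u = v" if "orb x = orb y" "x \<in> S u" "y \<in> S v" for x y u v
  proof -
    have x: "x \<in> tuples_at D q u" "y \<in> tuples_at D q v" using that assms by auto
    then have "x \<in> X" "fst x = u" "fst y = v" by (auto simp: X_def tuples_at_def)
    then show ?thesis using orb_refl[of x] that(1) by (auto simp: orb_def fst_T)
  qed
  then show ?thesis by (auto simp: pairwise_def disjnt_iff)
qed

lemma orbit_eq: "x \<in> tuples_at D q u \<Longrightarrow> orbit (vertex_group (int_bundle (Obj D)) u) act x = orb x"
  unfolding orbit_def orb_def vertex_group_def by (auto simp: T_def tuples_at_def)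

lemma orbits_eq:
  assumes "S \<subseteq> tuples_at D q u"
  shows "orbits (vertex_group (int_bundle (Obj D)) u) S act = orb ` S"
proof -
  have "orbit (vertex_group (int_bundle (Obj D)) u) act ` S = orb ` S"
    by (rule image_cong[OF refl]) (use orbit_eq assms in blast)
  then show ?thesis by (simp only: orbits_def Setcompr_eq_image)
qed

lemma periodic_points_eq:
  "periodic_points (vertex_group (int_bundle (Obj D)) u) (tuples_at D q u) act = {x \<in> tuples_at D q u. finite (orb x)}"
  unfolding periodic_points_def by (rule Collect_cong) (metis orbit_eq)

text \<open>The element \<open>(u, k)\<close> has a fixed object, whereas \<open>T k\<close> reads
  the object from the point; the two agree on tuples at \<open>u\<close>.\<close>

lemma linear_act_eq:
  assumes "z \<in> carrier (free_Abelian_group (tuples_at D q u))"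
  shows "linear_act (\<lambda>k. act (u, k)) k z = linear_act T k z"
  unfolding linear_act_def using assms
  by (intro frag_extend_eq) (auto simp: T_def tuples_at_def)

lemma invariant_subgroup_eq:
  "invariant_subgroup integer_group (free_Abelian_group (tuples_at D q u)) (linear_act (\<lambda>k. act (u, k)))
    = invariant_subgroup integer_group (free_Abelian_group (tuples_at D q u)) (linear_act T)"
  unfolding invariant_subgroup_def using linear_act_eq by (metis (mono_tags, lifting))

lemma coinvariants_eq:
  "coinvariants integer_group (free_Abelian_group (tuples_at D q u)) (linear_act (\<lambda>k. act (u, k)))
    = coinvariants integer_group (free_Abelian_group (tuples_at D q u)) (linear_act T)"
proof -
  have "{linear_act (\<lambda>k. act (u, k)) g x \<otimes>\<^bsub>free_Abelian_group (tuples_at D q u)\<^esub>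
          inv\<^bsub>free_Abelian_group (tuples_at D q u)\<^esub> x |g x.
          g \<in> carrier integer_group \<and> x \<in> carrier (free_Abelian_group (tuples_at D q u))}
      = {linear_act T g x \<otimes>\<^bsub>free_Abelian_group (tuples_at D q u)\<^esub>
          inv\<^bsub>free_Abelian_group (tuples_at D q u)\<^esub> x |g x.
          g \<in> carrier integer_group \<and> x \<in> carrier (free_Abelian_group (tuples_at D q u))}"
    using linear_act_eq by (intro Collect_cong ex_cong1) auto
  then show ?thesis unfolding coinvariants_def by simp
qed

end

section \<open>Assembly over all objects\<close>

theorem proposition6p6:
  fixes D :: "('o, 'd) cat"
    and lact :: "'o \<times> int \<Rightarrow> 'd \<Rightarrow> 'd"
    and ract :: "'o \<times> int \<Rightarrow> 'd \<Rightarrow> 'o \<times> int"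
    and q :: nat
  defines "C \<equiv> int_bundle (Obj D)"
  defines "act \<equiv> tuple_act C D lact ract"
  defines "H \<equiv> \<lambda>p. row_homology C D lact ract p q"
  defines "Orb \<equiv> \<lambda>u. free_Abelian_group (orbits (vertex_group C u) (tuples_at D q u) act)"
  defines "PerOrb \<equiv> \<lambda>u. free_Abelian_group (orbits (vertex_group C u)
             (periodic_points (vertex_group C u) (tuples_at D q u) act) act)"
  defines "M \<equiv> \<lambda>u. free_Abelian_group (tuples_at D q u)"
  defines "Mact \<equiv> \<lambda>u. linear_act (\<lambda>k::int. act (u, k))"
  assumes "matched_pair C D lact ract"
  shows
    "(\<exists>\<alpha>\<^sub>0 \<in> iso (sum_group (Obj D) Orb) (H 0).
        \<forall>u \<in> Obj D. \<forall>d \<in> tuples_at D q u.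
          \<alpha>\<^sub>0 (sum_inj (Obj D) Orb u (frag_of (orbit (vertex_group C u) act d)))
          = row_image C D lact ract 0 q #>\<^bsub>row_chain C D 0 q\<^esub> frag_of ([], d))
   \<and> (\<exists>\<alpha>\<^sub>1 \<in> iso (sum_group (Obj D) PerOrb) (H 1).
        \<forall>u \<in> Obj D. \<forall>d \<in> periodic_points (vertex_group C u) (tuples_at D q u) act.
          \<alpha>\<^sub>1 (sum_inj (Obj D) PerOrb u (frag_of (orbit (vertex_group C u) act d)))
          = row_image C D lact ract 1 q #>\<^bsub>row_chain C D 1 q\<^esub>
              (\<Sum>d' \<in> orbit (vertex_group C u) act d. frag_of ([(fst d', 1)], d')))
   \<and> H 0 \<cong> sum_group (Obj D) (\<lambda>u. coinvariants integer_group (M u) (Mact u))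
   \<and> H 1 \<cong> sum_group (Obj D) (\<lambda>u. invariant_subgroup integer_group (M u) (Mact u))
   \<and> (\<forall>p \<ge> 2. trivial_group (H p))
   \<and> sum_group (Obj D) (\<lambda>u. coinvariants integer_group (M u) (Mact u)) \<cong> sum_group (Obj D) Orb
   \<and> sum_group (Obj D) (\<lambda>u. invariant_subgroup integer_group (M u) (Mact u)) \<cong> sum_group (Obj D) PerOrb"
proof -
  interpret P: int_matched_pair D lact ract q
    using assms(8) by (simp add: int_matched_pair_def C_def)
  let ?Per = "\<lambda>u. {x \<in> tuples_at D q u. finite (P.orb x)}"
  have Orb: "Orb = (\<lambda>u. free_Abelian_group (P.orb ` tuples_at D q u))"
    unfolding Orb_def C_def act_def by (simp add: P.orbits_eq)
  have PerOrb: "PerOrb = (\<lambda>u. free_Abelian_group (P.orb ` ?Per u))"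
    unfolding PerOrb_def C_def act_def by (simp add: P.orbits_eq P.periodic_points_eq)
  obtain a where a: "a \<in> iso (free_Abelian_group (P.orb ` P.X)) (H 0)"
    "\<And>x. x \<in> P.X \<Longrightarrow> a (frag_of (P.orb x)) = row_image C D lact ract 0 q #>\<^bsub>row_chain C D 0 q\<^esub> frag_of ([], x)"
    using P.iso_Hom_0 unfolding H_def C_def by blast
  obtain b where b: "b \<in> iso (free_Abelian_group (P.orb ` P.Per)) (H 1)"
    "\<And>x. x \<in> P.Per \<Longrightarrow> b (frag_of (P.orb x)) = row_image C D lact ract 1 q #>\<^bsub>row_chain C D 1 q\<^esub>
       (\<Sum>y\<in>P.orb x. frag_of ([(fst y, 1)], y))"
    using P.iso_Hom_1 unfolding H_def C_def by blast
  \<comment> \<open>Orbits over different objects are disjoint, so \<open>a\<close>, defined on the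
    free group over all orbits, transfers to the direct sum over objects.\<close>
  obtain \<alpha>\<^sub>0 where \<alpha>\<^sub>0: "\<alpha>\<^sub>0 \<in> iso (sum_group (Obj D) Orb) (H 0)"
    "\<And>u x. u \<in> Obj D \<Longrightarrow> \<alpha>\<^sub>0 (sum_inj (Obj D) Orb u x) = a x"
    using iso_from_sum_free_Abelian_groups[OF P.disjnt_orbits[where S = "tuples_at D q"], where I = "Obj D" and \<alpha>' = a and H = "H 0"] a(1)
    unfolding Orb P.Union_orb by auto
  obtain \<alpha>\<^sub>1 where \<alpha>\<^sub>1: "\<alpha>\<^sub>1 \<in> iso (sum_group (Obj D) PerOrb) (H 1)"
    "\<And>u x. u \<in> Obj D \<Longrightarrow> \<alpha>\<^sub>1 (sum_inj (Obj D) PerOrb u x) = b x"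
    using iso_from_sum_free_Abelian_groups[OF P.disjnt_orbits[where S = ?Per], where I = "Obj D" and \<alpha>' = b and H = "H 1"] b(1)
    unfolding PerOrb P.Union_orb_Per by auto
  have orbit: "orbit (vertex_group C u) act x = P.orb x" if "x \<in> tuples_at D q u" for x u
    using P.orbit_eq[OF that] by (simp add: C_def act_def)
  have mem_X: "x \<in> P.X" if "u \<in> Obj D" "x \<in> tuples_at D q u" for x u
    using that by (auto simp: P.X_def)
  have per: "periodic_points (vertex_group C u) (tuples_at D q u) act = ?Per u" for u
    using P.periodic_points_eq by (simp add: C_def act_def)
  have group_Orb: "group (sum_group (Obj D) Orb)" "group (sum_group (Obj D) PerOrb)"
    by (simp_all add: Orb PerOrb)
  \<comment> \<open>Coinvariants and invariants are computed at each object \<open>u\<close>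
    separately, by the action of the integers on the tuples at \<open>u\<close>, and summed
    afterwards.\<close>
  have group_coinv: "group (coinvariants integer_group (M u) (Mact u))"
    and coinv: "Orb u \<cong> coinvariants integer_group (M u) (Mact u)"
    and inv: "PerOrb u \<cong> invariant_subgroup integer_group (M u) (Mact u)" for u
  proof -
    interpret U: int_action "tuples_at D q u" P.T by (rule P.int_action_tuples_at)
    show "group (coinvariants integer_group (M u) (Mact u))"
      using U.group_coinvariants P.coinvariants_eq[of u] by (simp add: M_def Mact_def act_def C_def)
    show "Orb u \<cong> coinvariants integer_group (M u) (Mact u)"
      using U.iso_coinvariants P.coinvariants_eq[of u] by (simp add: Orb M_def Mact_def act_def C_def)
    show "PerOrb u \<cong> invariant_subgroup integer_group (M u) (Mact u)"
      using is_isoI[OF U.iso_invariants] P.invariant_subgroup_eq[of u]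
      by (simp add: PerOrb M_def Mact_def act_def C_def U.Per_def)
  qed
  have group_inv: "group (invariant_subgroup integer_group (M u) (Mact u))" for u
    unfolding invariant_subgroup_def M_def by (simp add: group.group_subgroup_generated)
  have coinv_sum: "sum_group (Obj D) Orb \<cong> sum_group (Obj D) (\<lambda>u. coinvariants integer_group (M u) (Mact u))"
    using coinv group_coinv by (intro iso_sum_groupI) (auto simp: Orb)
  have inv_sum: "sum_group (Obj D) PerOrb \<cong> sum_group (Obj D) (\<lambda>u. invariant_subgroup integer_group (M u) (Mact u))"
    using inv group_inv by (intro iso_sum_groupI) (auto simp: PerOrb)
  have H: "H 0 \<cong> sum_group (Obj D) Orb" "H 1 \<cong> sum_group (Obj D) PerOrb"
    using \<alpha>\<^sub>0(1) \<alpha>\<^sub>1(1) group_Orb by (blast intro: group.iso_sym is_isoI)+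
  show ?thesis
  proof (intro conjI)
    show "\<exists>\<alpha>\<^sub>0 \<in> iso (sum_group (Obj D) Orb) (H 0). \<forall>u \<in> Obj D. \<forall>d \<in> tuples_at D q u.
          \<alpha>\<^sub>0 (sum_inj (Obj D) Orb u (frag_of (orbit (vertex_group C u) act d)))
          = row_image C D lact ract 0 q #>\<^bsub>row_chain C D 0 q\<^esub> frag_of ([], d)"
      by (rule bexI[OF _ \<alpha>\<^sub>0(1)]) (simp add: \<alpha>\<^sub>0(2) orbit a(2) mem_X)
    show "\<exists>\<alpha>\<^sub>1 \<in> iso (sum_group (Obj D) PerOrb) (H 1).
        \<forall>u \<in> Obj D. \<forall>d \<in> periodic_points (vertex_group C u) (tuples_at D q u) act.
          \<alpha>\<^sub>1 (sum_inj (Obj D) PerOrb u (frag_of (orbit (vertex_group C u) act d)))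
          = row_image C D lact ract 1 q #>\<^bsub>row_chain C D 1 q\<^esub>
              (\<Sum>d' \<in> orbit (vertex_group C u) act d. frag_of ([(fst d', 1)], d'))"
      by (rule bexI[OF _ \<alpha>\<^sub>1(1)]) (simp add: per \<alpha>\<^sub>1(2) orbit b(2) mem_X P.Per_def)
    show "\<forall>p \<ge> 2. trivial_group (H p)" using P.trivial_Hom by (simp add: H_def C_def)
  qed (use H coinv_sum inv_sum group_Orb in \<open>blast intro: iso_trans group.iso_sym\<close>)+
qed

end
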